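(* Let $n\ge 2$ and let $|\psi\rangle$ be an $n$-qubit pure state on subsystems $A_1,\dots,A_n$ that admits a Schmidt decomposition $$|\psi\rangle=\sum_{i=1}^{2}\sqrt{p_i}\;|i_{A_1}\rangle\otimes\cdots\otimes|i_{A_n}\rangle,$$ where for each $k$ the set $\{|1_{A_k}\rangle,|2_{A_k}\rangle\}$ is an orthonormal basis of the qubit $A_k$, $p_i\ge 0$ and $p_1+p_2=1$. Let $\rho=|\psi\rangle\langle\psi|$ and $S=-\sum_{i=1}^2 p_i\log_2 p_i$ (with $0\log_2 0=0$). Then the thermal global quantum discord of $\rho$ equals $S$, and it exactly quantifies the total quantum advantage in work extraction: $$\Delta W_t \;=\; k\,T\,\mathcal D_{th}(A_1:\cdots:A_n)\;=\;k\,T\,S .$$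
   Context: $k>0$ (Boltzmann constant) and $T>0$ (temperature) are fixed constants; $\log=\log_2$; $S(\rho)=-\mathrm{Tr}\,\rho\log\rho$ applied to a density operator is the von Neumann entropy and $H(\{p_a\})=-\sum_a p_a\log p_a$ is the Shannon entropy. A local measurement on a subsystem $A$ is a complete rank-one orthogonal projective measurement $\{\Pi_A^j\}$, i.e. the family of projectors onto the vectors of an orthonormal basis of $\mathcal H_A$. Non-selective measurements. For $1\le m\le n$ and a choice of local measurements $\{\Pi_{A_1}^{j_1}\},\dots,\{\Pi_{A_m}^{j_m}\}$ on $A_1,\dots,A_m$, $$\Phi_{A_1\cdots A_m}(\rho)=\sum_{j_1,\dots,j_m}\big(\Pi_{A_1}^{j_1}\otimes\cdots\otimes\Pi_{A_m}^{j_m}\otimes I\big)\,\rho\,\big(\Pi_{A_1}^{j_1}\otimes\cdots\otimes\Pi_{A_m}^{j_m}\otimes I\big),$$ where $I$ is the identity on the remaining subsystems. Thermal global quantum discord (GQD) of $\rho$: $$\mathcal D_{th}(A_1:\cdots:A_n)=\min_{\Phi}\big[S(\Phi_{A_1\cdots A_n}(\rho))-S(\rho)\big],$$ the minimum being over all choices of local measurements on $A_1,\dots,A_n$. Asymmetric bipartite thermal quantum discord. For a state $\sigma$ of the composite system and a subsystem $A=A_i$, let $R$ denote the collection of all the other subsystems, and let $\sigma_A,\sigma_R$ be the reduced states. The quantum mutual information is $I(\sigma)=S(\sigma_R)+S(\sigma_A)-S(\sigma)$. For a local measurement $\{\Pi_A^j\}$ put $\Phi_A(\sigma)=\sum_j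 (I_R\otimes\Pi_A^j)\,\sigma\,(I_R\otimes\Pi_A^j)$ and $q_j=\mathrm{Tr}[(I_R\otimes\Pi_A^j)\sigma]$. Then $$\mathcal D_{th}(\sigma\,|\,A)=\min_{\{\Pi_A^j\}}\Big\{\big[I(\sigma)-I(\Phi_A(\sigma))\big]+\big[H(\{q_j\})-S(\sigma_A)\big]\Big\},$$ the minimum being over all local measurements on $A$. Total quantum advantage. The total work difference between the quantum and the (best) classical Maxwell's demon, in the protocol that sequentially uses $A_i$ of the $i$-th copy of $\rho$ as apparatus, is $$\Delta W_t = k\,T\,\sum_{i=1}^{n}\ \min_{\Phi_{A_1\cdots A_{i-1}}}\ \mathcal D_{th}\big(\Phi_{A_1\cdots A_{i-1}}(\rho)\,\big|\,A_i\big),$$ where for $i\ge2$ the minimum is over all local non-selective measurements on $A_1,\dots,A_{i-1}$, and the $i=1$ term is $\mathcal D_{th}(\rho\,|\,A_1)$. *)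

theory Defs
  imports Complex_Main "HOL-Library.FuncSet" "Jordan_Normal_Form.Schur_Decomposition"
begin

text \<open>
  Operators are complex matrices with explicit dimensions.
  The space of \<open>n\<close> qubits has dimension \<open>2 ^ n\<close>; the qubits are numbered \<open>0, \<dots>, n - 1\<close>
  (so \<open>A\<^sub>i\<close> is qubit \<open>i - 1\<close>), and the index \<open>s < 2 ^ n\<close> stands for the computational basis
  vector whose \<open>k\<close>-th tensor factor is the \<open>k\<close>-th binary digit of \<open>s\<close>.
\<close>

definition outer_prod :: "complex vec \<Rightarrow> complex vec \<Rightarrow> complex mat" where
  "outer_prod v w = mat (dim_vec v) (dim_vec w) (\<lambda>(i, j). v $ i * cnj (w $ j))"

definition mat_trace :: "complex mat \<Rightarrow> complex" where
  "mat_trace A = (\<Sum>i<dim_row A. A $$ (i, i))"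

definition mat_sum :: "nat \<Rightarrow> ('j \<Rightarrow> complex mat) \<Rightarrow> 'j set \<Rightarrow> complex mat" where
  "mat_sum N f J = mat N N (\<lambda>(s, t). \<Sum>j\<in>J. f j $$ (s, t))"

definition orthonormal_basis :: "nat \<Rightarrow> (nat \<Rightarrow> complex vec) \<Rightarrow> bool" where
  "orthonormal_basis d u \<longleftrightarrow>
     (\<forall>j<d. u j \<in> carrier_vec d) \<and>
     (\<forall>i<d. \<forall>j<d. u i \<bullet>c u j = (if i = j then 1 else 0))"

text \<open>
  The logarithm of a positive semidefinite matrix by functional calculus; the result does not
  depend on the unitary diagonalization that is chosen.
  Since \<open>log 2 0 = 0\<close> in HOL, the logarithm is \<open>0\<close> on the kernel, which gives the
  convention \<open>0 log 0 = 0\<close> in the entropies.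
\<close>

definition mat_log2 :: "complex mat \<Rightarrow> complex mat" where
  "mat_log2 A = (SOME L. \<exists>U (d :: nat \<Rightarrow> real).
     U \<in> carrier_mat (dim_row A) (dim_row A) \<and>
     U * mat_adjoint U = 1\<^sub>m (dim_row A) \<and>
     A = U * mat_diag (dim_row A) (\<lambda>i. complex_of_real (d i)) * mat_adjoint U \<and>
     L = U * mat_diag (dim_row A) (\<lambda>i. complex_of_real (log 2 (d i))) * mat_adjoint U)"

definition von_neumann_entropy :: "complex mat \<Rightarrow> real" where
  "von_neumann_entropy \<rho> = - Re (mat_trace (\<rho> * mat_log2 \<rho>))"

definition shannon_entropy :: "nat \<Rightarrow> (nat \<Rightarrow> real) \<Rightarrow> real" where
  "shannon_entropy d q = - (\<Sum>j<d. q j * log 2 (q j))"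

definition qubit_digit :: "nat \<Rightarrow> nat \<Rightarrow> nat" where
  "qubit_digit s k = s div 2 ^ k mod 2"

definition tensor_vec :: "nat \<Rightarrow> (nat \<Rightarrow> complex vec) \<Rightarrow> complex vec" where
  "tensor_vec n v = vec (2 ^ n) (\<lambda>s. \<Prod>k<n. v k $ qubit_digit s k)"

definition tensor_mat :: "nat \<Rightarrow> (nat \<Rightarrow> complex mat) \<Rightarrow> complex mat" where
  "tensor_mat n M = mat (2 ^ n) (2 ^ n)
     (\<lambda>(s, t). \<Prod>k<n. M k $$ (qubit_digit s k, qubit_digit t k))"

text \<open>The basis index of \<open>n\<close> qubits with digit \<open>a\<close> at position \<open>k\<close> and the digits of \<open>r\<close>, in order,
  at the other \<open>n - 1\<close> positions.\<close>

definition insert_digit :: "nat \<Rightarrow> nat \<Rightarrow> nat \<Rightarrow> nat" where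
  "insert_digit k a r = r mod 2 ^ k + a * 2 ^ k + (r div 2 ^ k) * 2 ^ (k + 1)"

text \<open>The reduced states on qubit \<open>k\<close> and on the remaining \<open>n - 1\<close> qubits.\<close>

definition reduced_site :: "nat \<Rightarrow> nat \<Rightarrow> complex mat \<Rightarrow> complex mat" where
  "reduced_site n k \<sigma> = mat 2 2
     (\<lambda>(a, b). \<Sum>r<2 ^ (n - 1). \<sigma> $$ (insert_digit k a r, insert_digit k b r))"

definition reduced_rest :: "nat \<Rightarrow> nat \<Rightarrow> complex mat \<Rightarrow> complex mat" where
  "reduced_rest n k \<sigma> = mat (2 ^ (n - 1)) (2 ^ (n - 1))
     (\<lambda>(r, s). \<Sum>a<2. \<sigma> $$ (insert_digit k a r, insert_digit k a s))"

text \<open>A local measurement of a qubit is given by an orthonormal basis of it. In the non-selective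
  measurement of the first \<open>m\<close> of \<open>n\<close> qubits, \<open>b k\<close> is the basis used on qubit \<open>k\<close>.\<close>

definition first_projector :: "nat \<Rightarrow> nat \<Rightarrow> (nat \<Rightarrow> nat \<Rightarrow> complex vec) \<Rightarrow> (nat \<Rightarrow> nat) \<Rightarrow> complex mat" where
  "first_projector n m b j =
     tensor_mat n (\<lambda>k. if k < m then outer_prod (b k (j k)) (b k (j k)) else 1\<^sub>m 2)"

definition measure_first ::
    "nat \<Rightarrow> nat \<Rightarrow> (nat \<Rightarrow> nat \<Rightarrow> complex vec) \<Rightarrow> complex mat \<Rightarrow> complex mat" where
  "measure_first n m b \<rho> = mat_sum (2 ^ n)
     (\<lambda>j. first_projector n m b j * \<rho> * first_projector n m b j) ({..<m} \<rightarrow>\<^sub>E {..<2})"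

definition site_projector :: "nat \<Rightarrow> nat \<Rightarrow> complex vec \<Rightarrow> complex mat" where
  "site_projector n k v = tensor_mat n (\<lambda>l. if l = k then outer_prod v v else 1\<^sub>m 2)"

definition measure_site ::
    "nat \<Rightarrow> nat \<Rightarrow> (nat \<Rightarrow> complex vec) \<Rightarrow> complex mat \<Rightarrow> complex mat" where
  "measure_site n k u \<sigma> = mat_sum (2 ^ n)
     (\<lambda>j. site_projector n k (u j) * \<sigma> * site_projector n k (u j)) {..<2}"

definition outcome_prob ::
    "nat \<Rightarrow> nat \<Rightarrow> (nat \<Rightarrow> complex vec) \<Rightarrow> complex mat \<Rightarrow> nat \<Rightarrow> real" where
  "outcome_prob n k u \<sigma> j = Re (mat_trace (site_projector n k (u j) * \<sigma>))"

definition mutual_information :: "nat \<Rightarrow> nat \<Rightarrow> complex mat \<Rightarrow> real" where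
  "mutual_information n k \<sigma> =
     von_neumann_entropy (reduced_rest n k \<sigma>) + von_neumann_entropy (reduced_site n k \<sigma>)
     - von_neumann_entropy \<sigma>"

text \<open>The minima below are over infinite sets of reals; \<open>LEAST\<close> denotes the smallest element
  (not merely the infimum).\<close>

definition thermal_gqd :: "nat \<Rightarrow> complex mat \<Rightarrow> real" where
  "thermal_gqd n \<rho> = (LEAST x. \<exists>b. (\<forall>k<n. orthonormal_basis 2 (b k)) \<and>
     x = von_neumann_entropy (measure_first n n b \<rho>) - von_neumann_entropy \<rho>)"

definition thermal_discord :: "nat \<Rightarrow> complex mat \<Rightarrow> nat \<Rightarrow> real" where
  "thermal_discord n \<sigma> k = (LEAST x. \<exists>u. orthonormal_basis 2 u \<and>
     x = (mutual_information n k \<sigma> - mutual_information n k (measure_site n k u \<sigma>))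
       + (shannon_entropy 2 (outcome_prob n k u \<sigma>) - von_neumann_entropy (reduced_site n k \<sigma>)))"

definition total_work_difference :: "real \<Rightarrow> real \<Rightarrow> nat \<Rightarrow> complex mat \<Rightarrow> real" where
  "total_work_difference kB T n \<rho> = kB * T *
     (thermal_discord n \<rho> 0 +
      (\<Sum>i = 1..<n. LEAST x. \<exists>b. (\<forall>k<i. orthonormal_basis 2 (b k)) \<and>
         x = thermal_discord n (measure_first n i b \<rho>) i))"

end

theory Submission
  imports "HOL-Analysis.Topology_Euclidean_Space" Defs
begin

text \<open>
  Measuring the first \<open>m\<close> qubits of a pure state \<open>\<psi>\<close> yields the sum of the projectors onto the
  mutually orthogonal branches \<open>P\<^sub>j \<psi>\<close>, so its entropy is the Shannon entropy of the squared norms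
  of the branches. The functional minimized in the asymmetric discord is the entropy gained
  by the local measurement, because the state of the other qubits does not change and the
  measured qubit gets the entropy of the outcome distribution. A further measurement splits the
  branches and cannot lower the entropy. For a Schmidt state the very first measurement already
  produces at least the entropy \<open>S\<close>, by concavity, and measuring in the Schmidt bases
  produces exactly \<open>S\<close> however many qubits are measured. Hence the first term of the total
  work difference is \<open>S\<close>, the others vanish, and the global discord is \<open>S\<close>.
\<close>

unbundle no vec_syntax

section \<open>Entropy of orthogonal sums of rank-one matrices\<close>

text \<open>Two features of the definitions shape the argument. \<open>mat_log2\<close> selects an
  unspecified diagonalization, so an entropy can be evaluated only through what all choices share,
  namely the action on eigenvectors. Every state whose entropy is evaluated is therefore kept as a
  sum of rank-one matrices over mutually orthogonal, unnormalized vectors, whose eigenvectors are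
  visible; the other entropies cancel. Secondly, \<open>LEAST\<close> says nothing useful about a
  set without a least element, so a lower bound on a discord requires an attained minimum. For the
  later terms this is needed for every choice of the earlier measurements, and it comes from
  compactness of the unit sphere of a qubit. The bound \<open>S\<close> cannot be read off directly
  when all qubits are measured, since the two Schmidt terms may then interfere in the outcome
  probabilities. After one measurement an untouched qubit remains, because \<open>n >= 2\<close>,
  and it kills the cross term; the bound is proved there and carried upwards by
  monotonicity.\<close>

definition sq_norm_cvec :: "complex vec \<Rightarrow> real" where
  "sq_norm_cvec v = (\<Sum>i<dim_vec v. (cmod (v $ i))\<^sup>2)"

definition orthonormal_family :: "nat \<Rightarrow> nat \<Rightarrow> (nat \<Rightarrow> complex vec) \<Rightarrow> bool" where
  "orthonormal_family N k u \<longleftrightarrow> (\<forall>i<k. u i \<in> carrier_vec N) \<and>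
     (\<forall>i<k. \<forall>j<k. u i \<bullet>c u j = (if i = j then 1 else 0))"

lemma orthonormal_basis_iff_family: "orthonormal_basis d u \<longleftrightarrow> orthonormal_family d d u"
  by (simp add: orthonormal_basis_def orthonormal_family_def)

section \<open>Coordinate formulas for inner products, matrix products and adjoints\<close>

lemma cscalar_prod_sum: "w \<in> carrier_vec N \<Longrightarrow> v \<bullet>c w = (\<Sum>i<N. v $ i * cnj (w $ i))"
  by (auto simp: scalar_prod_def atLeast0LessThan intro!: sum.cong)

lemma cscalar_prod_self: "v \<bullet>c v = complex_of_real (sq_norm_cvec v)"
  by (simp add: cscalar_prod_sum[of v "dim_vec v"] sq_norm_cvec_def flip: complex_norm_square)

lemma sq_norm_cvec_nonneg: "sq_norm_cvec v \<ge> 0"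
  by (simp add: sq_norm_cvec_def sum_nonneg)

lemma sq_norm_cvec_eq_0: "v \<in> carrier_vec N \<Longrightarrow> sq_norm_cvec v = 0 \<longleftrightarrow> v = 0\<^sub>v N"
  by (auto simp: sq_norm_cvec_def sum_nonneg_eq_0_iff)

lemma sq_norm_cvec_smult: "sq_norm_cvec (c \<cdot>\<^sub>v v) = (cmod c)\<^sup>2 * sq_norm_cvec v"
  by (simp add: sq_norm_cvec_def sum_distrib_left norm_mult power_mult_distrib)

lemma cscalar_prod_smult_left:
  "v \<in> carrier_vec N \<Longrightarrow> w \<in> carrier_vec N \<Longrightarrow> (a \<cdot>\<^sub>v v) \<bullet>c w = a * (v \<bullet>c w)"
  by simp

lemma cscalar_prod_smult_right:
  "v \<in> carrier_vec N \<Longrightarrow> w \<in> carrier_vec N \<Longrightarrow> v \<bullet>c (a \<cdot>\<^sub>v w) = cnj a * (v \<bullet>c w)"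
  by (simp add: cscalar_prod_sum[of _ N] sum_distrib_left mult_ac)

lemma cscalar_prod_commute:
  "v \<in> carrier_vec N \<Longrightarrow> w \<in> carrier_vec N \<Longrightarrow> w \<bullet>c v = cnj (v \<bullet>c w)"
  by (simp add: cscalar_prod_sum[of _ N] mult_ac)

lemma mult_mat_vec_index:
  "A \<in> carrier_mat n m \<Longrightarrow> v \<in> carrier_vec m \<Longrightarrow> i < n \<Longrightarrow> (A *\<^sub>v v) $ i = (\<Sum>j<m. A $$ (i, j) * v $ j)"
  by (auto simp: scalar_prod_def atLeast0LessThan)

lemma mult_mat_index:
  "A \<in> carrier_mat n m \<Longrightarrow> B \<in> carrier_mat m l \<Longrightarrow> i < n \<Longrightarrow> j < l \<Longrightarrow>
   (A * B) $$ (i, j) = (\<Sum>k<m. A $$ (i, k) * B $$ (k, j))"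
  by (auto simp: scalar_prod_def atLeast0LessThan)

lemma mat_adjoint_carrier: "A \<in> carrier_mat n m \<Longrightarrow> mat_adjoint A \<in> carrier_mat m n"
  unfolding mat_adjoint_def by (metis carrier_matD cols_length length_map mat_of_rows_carrier(1))

lemma mat_adjoint_index:
  assumes "A \<in> carrier_mat n m" "i < m" "j < n"
  shows "mat_adjoint A $$ (i, j) = cnj (A $$ (j, i))"
  using assms unfolding mat_adjoint_def by (auto simp: mat_of_rows_index)

text \<open>A unit vector lies in the kernel of the transpose, so the determinant vanishes. Padding
  a rectangular system with zero rows turns dimension counts into this determinant
  criterion.\<close>

lemma zero_row_kernel:
  fixes M :: "complex mat"
  assumes M: "M \<in> carrier_mat N N" and k: "k < N" and z: "\<And>j. j < N \<Longrightarrow> M $$ (k, j) = 0"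
  obtains w where "w \<in> carrier_vec N" "w \<noteq> 0\<^sub>v N" "M *\<^sub>v w = 0\<^sub>v N"
proof -
  have "transpose_mat M *\<^sub>v unit_vec N k = 0\<^sub>v N"
  proof (rule eq_vecI)
    fix i assume i: "i < dim_vec (0\<^sub>v N)"
    have "(transpose_mat M *\<^sub>v unit_vec N k) $ i = (\<Sum>j<N. transpose_mat M $$ (i, j) * unit_vec N k $ j)"
      using M i by (intro mult_mat_vec_index) auto
    also have "\<dots> = 0"
      using M i z by (intro sum.neutral) (auto simp: unit_vec_def)
    finally show "(transpose_mat M *\<^sub>v unit_vec N k) $ i = 0\<^sub>v N $ i" using i by simp
  qed (use M in auto)
  moreover have "unit_vec N k \<noteq> (0\<^sub>v N :: complex vec)" using k by simp
  ultimately have "det (transpose_mat M) = 0"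
    using M by (subst det_0_iff_vec_prod_zero[of _ N]) (auto intro!: exI[of _ "unit_vec N k"])
  then have "det M = 0" using det_transpose[OF M] by simp
  then show ?thesis using that M by (auto simp: det_0_iff_vec_prod_zero[of _ N])
qed

lemma orthonormal_family_complement:
  assumes u: "orthonormal_family N k u" and k: "k < N"
  obtains w where "w \<in> carrier_vec N" "w \<bullet>c w = 1" "\<And>i. i < k \<Longrightarrow> w \<bullet>c u i = 0"
proof -
  \<comment> \<open>Orthogonality to the family gives only \<open>k < N\<close> equations; zero rows
    make the system square.\<close>
  let ?M = "mat N N (\<lambda>(i, j). if i < k then cnj (u i $ j) else 0)"
  obtain w where w: "w \<in> carrier_vec N" "w \<noteq> 0\<^sub>v N" "?M *\<^sub>v w = 0\<^sub>v N"
    using k by (rule_tac zero_row_kernel[of ?M N k]) auto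
  have orth: "w \<bullet>c u i = 0" if i: "i < k" for i
  proof -
    have ui: "u i \<in> carrier_vec N" using u i by (auto simp: orthonormal_family_def)
    have "w \<bullet>c u i = (?M *\<^sub>v w) $ i"
      using i k w ui by (subst mult_mat_vec_index[of _ N N]) (auto simp: cscalar_prod_sum[of _ N] mult_ac)
    then show ?thesis using w i k by simp
  qed
  define r where "r = complex_of_real (1 / sqrt (sq_norm_cvec w))"
  have pos: "sq_norm_cvec w > 0"
    using sq_norm_cvec_nonneg[of w] sq_norm_cvec_eq_0[OF w(1)] w(2) by simp
  have "sq_norm_cvec (r \<cdot>\<^sub>v w) = 1"
    using pos by (simp add: sq_norm_cvec_smult r_def norm_divide power_divide)
  then have "(r \<cdot>\<^sub>v w) \<bullet>c (r \<cdot>\<^sub>v w) = 1" by (simp only: cscalar_prod_self) simp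
  moreover have "(r \<cdot>\<^sub>v w) \<bullet>c u i = 0" if "i < k" for i
    using orth[OF that] u that w by (subst cscalar_prod_smult_left[of _ N]) (auto simp: orthonormal_family_def)
  ultimately show ?thesis using that[of "r \<cdot>\<^sub>v w"] w by auto
qed

text \<open>With more than \<open>N\<close> vectors the coordinate matrix, padded with zero rows, is
  singular. Pairing the resulting linear dependency with \<open>u l\<close> isolates the coefficient
  \<open>c $ l\<close>, so the dependency would be trivial.\<close>

lemma orthonormal_family_le:
  assumes u: "orthonormal_family N k u"
  shows "k \<le> N"
proof (rule ccontr)
  assume "\<not> k \<le> N"
  then have N: "N < k" by simp
  let ?M = "mat k k (\<lambda>(i, j). if i < N then u j $ i else 0)"
  obtain c where c: "c \<in> carrier_vec k" "c \<noteq> 0\<^sub>v k" "?M *\<^sub>v c = 0\<^sub>v k"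
    using N by (rule_tac zero_row_kernel[of ?M k N]) auto
  have comb: "(\<Sum>j<k. u j $ i * c $ j) = 0" if "i < N" for i
  proof -
    have "(\<Sum>j<k. u j $ i * c $ j) = (?M *\<^sub>v c) $ i"
      using that N c by (subst mult_mat_vec_index[of _ k k]) auto
    then show ?thesis using c that N by simp
  qed
  have "c $ l = 0" if l: "l < k" for l
  proof -
    have ul: "u l \<in> carrier_vec N" using u l by (auto simp: orthonormal_family_def)
    have "c $ l = (\<Sum>j<k. if j = l then c $ j else 0)" using l by simp
    also have "\<dots> = (\<Sum>j<k. c $ j * (u j \<bullet>c u l))"
      using u l by (intro sum.cong) (auto simp: orthonormal_family_def)
    also have "\<dots> = (\<Sum>i<N. (\<Sum>j<k. u j $ i * c $ j) * cnj (u l $ i))"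
      unfolding cscalar_prod_sum[OF ul] sum_distrib_left sum_distrib_right
      by (subst sum.swap) (simp add: mult_ac)
    finally show ?thesis by (simp add: comb)
  qed
  then show False using c by (auto intro!: eq_vecI)
qed

text \<open>Induction on the number \<open>N - k\<close> of missing vectors. The subtraction is
  truncated, so the base case needs \<open>orthonormal_family_le\<close> to conclude
  \<open>k = N\<close>.\<close>

lemma orthonormal_family_extend:
  assumes "orthonormal_family N k u"
  obtains v where "orthonormal_family N N v" "\<And>i. i < k \<Longrightarrow> v i = u i"
proof -
  have "\<exists>v. orthonormal_family N N v \<and> (\<forall>i<k. v i = u i)"
    using assms
  proof (induction "N - k" arbitrary: k u)
    case 0
    then show ?case using orthonormal_family_le[of N k u] by (metis diff_is_0_eq le_antisym)
  next
    case (Suc n)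
    then have k: "k < N" by simp
    obtain w where w: "w \<in> carrier_vec N" "w \<bullet>c w = 1" "\<And>i. i < k \<Longrightarrow> w \<bullet>c u i = 0"
      using orthonormal_family_complement[OF Suc.prems k] by blast
    have w': "u i \<bullet>c w = 0" if "i < k" for i
      using w that cscalar_prod_commute[of w N "u i"] Suc.prems
      by (auto simp: orthonormal_family_def)
    have "orthonormal_family N (Suc k) (u(k := w))"
      using Suc.prems w w' unfolding orthonormal_family_def by (auto simp: less_Suc_eq)
    moreover have "n = N - Suc k" using Suc.hyps(2) by simp
    ultimately obtain v
      where "orthonormal_family N N v" "\<forall>i<Suc k. v i = (u(k := w)) i" using Suc.hyps(1) by blast
    then show ?case by (intro exI[of _ v]) auto
  qed
  then show ?thesis using that by blast
qed

text \<open>Two diagonalizations of \<open>A\<close> need not have the same eigenvectors, but any logarithm of \<open>A\<close>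
  acts on every eigenvector of \<open>A\<close> as the logarithm of its eigenvalue.\<close>

lemma mat_log2_eigenvector:
  assumes A: "A \<in> carrier_mat N N"
    and ex: "\<exists>U (d :: nat \<Rightarrow> real). U \<in> carrier_mat N N \<and> U * mat_adjoint U = 1\<^sub>m N \<and>
      A = U * mat_diag N (\<lambda>i. complex_of_real (d i)) * mat_adjoint U"
  shows "mat_log2 A \<in> carrier_mat N N"
    and "\<And>x q. x \<in> carrier_vec N \<Longrightarrow> A *\<^sub>v x = complex_of_real q \<cdot>\<^sub>v x \<Longrightarrow>
      mat_log2 A *\<^sub>v x = complex_of_real (log 2 q) \<cdot>\<^sub>v x"
proof -
  have dim: "dim_row A = N" using A by simp
  let ?P = "\<lambda>L. \<exists>U (d :: nat \<Rightarrow> real). U \<in> carrier_mat N N \<and> U * mat_adjoint U = 1\<^sub>m N \<and>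
     A = U * mat_diag N (\<lambda>i. complex_of_real (d i)) * mat_adjoint U \<and>
     L = U * mat_diag N (\<lambda>i. complex_of_real (log 2 (d i))) * mat_adjoint U"
  have "?P (mat_log2 A)"
    unfolding mat_log2_def dim by (rule someI_ex[of ?P]) (use ex in blast)
  then obtain U and d :: "nat \<Rightarrow> real" where U: "U \<in> carrier_mat N N"
    and UU: "U * mat_adjoint U = 1\<^sub>m N"
    and Ad: "A = U * mat_diag N (\<lambda>i. complex_of_real (d i)) * mat_adjoint U"
    and Ld: "mat_log2 A = U * mat_diag N (\<lambda>i. complex_of_real (log 2 (d i))) * mat_adjoint U"
    by blast
  let ?V = "mat_adjoint U"
  let ?D = "mat_diag N (\<lambda>i. complex_of_real (d i))"
  let ?E = "mat_diag N (\<lambda>i. complex_of_real (log 2 (d i)))"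
  have V: "?V \<in> carrier_mat N N" by (rule mat_adjoint_carrier[OF U])
  have D: "?D \<in> carrier_mat N N" and E: "?E \<in> carrier_mat N N" by auto
  have VU: "?V * U = 1\<^sub>m N" by (rule mat_mult_left_right_inverse[OF U V UU])
  show "mat_log2 A \<in> carrier_mat N N" unfolding Ld using U V E by (meson mult_carrier_mat)
  fix x q assume x: "x \<in> carrier_vec N" and ev: "A *\<^sub>v x = complex_of_real q \<cdot>\<^sub>v x"
  \<comment> \<open>\<open>y\<close> holds the coordinates of \<open>x\<close> in the eigenbasis
    given by \<open>U\<close>, in which \<open>A\<close> acts as the diagonal matrix of the
    \<open>d i\<close>.\<close>
  define y where "y = ?V *\<^sub>v x"
  have y: "y \<in> carrier_vec N" unfolding y_def using V x by auto
  have "?D *\<^sub>v y = (?V * U) *\<^sub>v (?D *\<^sub>v y)" 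
    unfolding VU using mult_mat_vec_carrier[OF D y] by (rule one_mult_mat_vec[symmetric])
  also have "\<dots> = ?V *\<^sub>v (U *\<^sub>v (?D *\<^sub>v y))" using V U mult_mat_vec_carrier[OF D y] by (rule assoc_mult_mat_vec)
  also have "U *\<^sub>v (?D *\<^sub>v y) = A *\<^sub>v x"
    unfolding Ad y_def using U D V x by (subst assoc_mult_mat_vec[of _ N N _ N] | auto)+
  also have "?V *\<^sub>v (A *\<^sub>v x) = complex_of_real q \<cdot>\<^sub>v y"
    unfolding ev y_def using V x by (rule mult_mat_vec)
  finally have Dy: "?D *\<^sub>v y = complex_of_real q \<cdot>\<^sub>v y" .
  have diag: "(mat_diag N f *\<^sub>v y) $ i = f i * y $ i" if "i < N" for i f
  proof -
    have "(mat_diag N f *\<^sub>v y) $ i = (\<Sum>j<N. mat_diag N f $$ (i, j) * y $ j)"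
      using y that by (intro mult_mat_vec_index) auto
    also have "\<dots> = (\<Sum>j<N. if j = i then f i * y $ i else 0)"
      using that by (intro sum.cong) (auto simp: mat_diag_def)
    also have "\<dots> = f i * y $ i" using that by simp
    finally show ?thesis .
  qed
  have "?E *\<^sub>v y = complex_of_real (log 2 q) \<cdot>\<^sub>v y"
  proof (rule eq_vecI)
    fix i assume "i < dim_vec (complex_of_real (log 2 q) \<cdot>\<^sub>v y)"
    then have i: "i < N" using y by simp
    have "complex_of_real (d i) * y $ i = (?D *\<^sub>v y) $ i" using diag[OF i] by simp
    also have "\<dots> = complex_of_real q * y $ i" unfolding Dy using y i by simp
    finally have "complex_of_real (d i) * y $ i = complex_of_real q * y $ i" .
    \<comment> \<open>On the support of \<open>y\<close> the eigenvalue \<open>d i\<close> equals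
      \<open>q\<close>, and elsewhere both sides vanish; so taking logarithms entry by entry has the
      same effect on \<open>x\<close> for every diagonalization.\<close>
    then have "y $ i = 0 \<or> d i = q" by auto
    then show "(?E *\<^sub>v y) $ i = (complex_of_real (log 2 q) \<cdot>\<^sub>v y) $ i"
      using diag[OF i, of "\<lambda>i. complex_of_real (log 2 (d i))"] y i by auto
  qed (use y in \<open>auto simp: mat_diag_def\<close>)
  then have "mat_log2 A *\<^sub>v x = U *\<^sub>v (complex_of_real (log 2 q) \<cdot>\<^sub>v y)"
    unfolding Ld y_def using U E V x by (subst assoc_mult_mat_vec[of _ N N _ N] | auto)+
  also have "\<dots> = complex_of_real (log 2 q) \<cdot>\<^sub>v (U *\<^sub>v y)" using U y by (rule mult_mat_vec)
  also have "U *\<^sub>v y = x" unfolding y_def using UU U V x by (subst assoc_mult_mat_vec[symmetric]) auto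
  finally show "mat_log2 A *\<^sub>v x = complex_of_real (log 2 q) \<cdot>\<^sub>v x" .
qed

section \<open>Orthonormal bases as unitary matrices\<close>

lemma orthonormal_family_unitary:
  assumes v: "orthonormal_family N N v"
  defines "U \<equiv> mat N N (\<lambda>(i, j). v j $ i)"
  shows "U * mat_adjoint U = 1\<^sub>m N"
proof -
  have vc: "v l \<in> carrier_vec N" if "l < N" for l using v that by (auto simp: orthonormal_family_def)
  have U: "U \<in> carrier_mat N N" by (simp add: U_def)
  have V: "mat_adjoint U \<in> carrier_mat N N" by (rule mat_adjoint_carrier[OF U])
  have "mat_adjoint U * U = 1\<^sub>m N"
  proof (rule eq_matI)
    fix i j assume "i < dim_row (1\<^sub>m N)" "j < dim_col (1\<^sub>m N)"
    then have i: "i < N" and j: "j < N" by auto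
    have "(mat_adjoint U * U) $$ (i, j) = (\<Sum>k<N. mat_adjoint U $$ (i, k) * U $$ (k, j))"
      using V U i j by (rule mult_mat_index)
    also have "\<dots> = v j \<bullet>c v i"
      using i j vc by (simp add: mat_adjoint_index[OF U] cscalar_prod_sum[of _ N]) (simp add: U_def mult_ac)
    finally show "(mat_adjoint U * U) $$ (i, j) = 1\<^sub>m N $$ (i, j)"
      using v i j by (simp add: orthonormal_family_def)
  qed (use U V in auto)
  then show ?thesis by (rule mat_mult_left_right_inverse[OF V U])
qed

text \<open>The resolution of the identity in entries: a unitary matrix has orthonormal rows as well
  as orthonormal columns.\<close>

lemma orthonormal_basis_complete:
  assumes u: "orthonormal_basis d u" and a: "a < d" and b: "b < d"
  shows "(\<Sum>k<d. u k $ a * cnj (u k $ b)) = (if a = b then 1 else 0)"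
proof -
  let ?U = "mat d d (\<lambda>(i, j). u j $ i)"
  have U: "?U \<in> carrier_mat d d" by simp
  have "(\<Sum>k<d. u k $ a * cnj (u k $ b)) = (\<Sum>k<d. ?U $$ (a, k) * mat_adjoint ?U $$ (k, b))"
    using a b by (intro sum.cong refl) (simp add: mat_adjoint_index[OF U])
  also have "\<dots> = (?U * mat_adjoint ?U) $$ (a, b)"
    by (rule mult_mat_index[OF U mat_adjoint_carrier[OF U] a b, symmetric])
  also have "?U * mat_adjoint ?U = 1\<^sub>m d"
    using u by (simp add: orthonormal_family_unitary orthonormal_basis_iff_family)
  finally show ?thesis using a b by simp
qed

lemma diagonalizable_if_orthonormal_eigenvectors:
  assumes A: "A \<in> carrier_mat N N" and v: "orthonormal_family N N v"
    and ev: "\<And>l. l < N \<Longrightarrow> A *\<^sub>v v l = complex_of_real (d l) \<cdot>\<^sub>v v l"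
  shows "\<exists>U (d :: nat \<Rightarrow> real). U \<in> carrier_mat N N \<and> U * mat_adjoint U = 1\<^sub>m N \<and>
      A = U * mat_diag N (\<lambda>i. complex_of_real (d i)) * mat_adjoint U"
proof -
  define U where "U = mat N N (\<lambda>(i, j). v j $ i)"
  let ?D = "mat_diag N (\<lambda>i. complex_of_real (d i))"
  have vc: "v l \<in> carrier_vec N" if "l < N" for l using v that by (auto simp: orthonormal_family_def)
  have U: "U \<in> carrier_mat N N" by (simp add: U_def)
  have V: "mat_adjoint U \<in> carrier_mat N N" by (rule mat_adjoint_carrier[OF U])
  note UU = orthonormal_family_unitary[OF v, folded U_def]
  have "A * U = U * ?D"
  proof (rule eq_matI)
    fix i j assume "i < dim_row (U * ?D)" "j < dim_col (U * ?D)"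
    then have i: "i < N" and j: "j < N" using U by (auto simp: mat_diag_def)
    have "(A * U) $$ (i, j) = (\<Sum>k<N. A $$ (i, k) * U $$ (k, j))" using A U i j by (rule mult_mat_index)
    also have "\<dots> = (A *\<^sub>v v j) $ i"
      unfolding mult_mat_vec_index[OF A vc[OF j] i] using j by (simp add: U_def)
    finally have "(A * U) $$ (i, j) = (A *\<^sub>v v j) $ i" .
    also have "\<dots> = complex_of_real (d j) * v j $ i" using ev[OF j] vc[OF j] i by simp
    also have "\<dots> = (U * ?D) $$ (i, j)" 
      using i j by (simp add: mat_diag_mult_right[OF U]) (simp add: U_def)
    finally show "(A * U) $$ (i, j) = (U * ?D) $$ (i, j)" .
  qed (use A U in \<open>auto simp: mat_diag_def\<close>)
  then have "U * ?D * mat_adjoint U = A * (U * mat_adjoint U)"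
    using A U V by (metis assoc_mult_mat)
  then have "A = U * ?D * mat_adjoint U" using A UU by simp
  then show ?thesis using U UU by blast
qed

section \<open>Spectrum and entropy of weighted sums of rank-one matrices\<close>

lemma orthogonal_sum_apply:
  assumes J: "finite J" and x: "\<And>j. j \<in> J \<Longrightarrow> x j \<in> carrier_vec N" and y: "y \<in> carrier_vec N"
    and i: "i < N"
  shows "(mat_sum N (\<lambda>j. complex_of_real (c j) \<cdot>\<^sub>m outer_prod (x j) (x j)) J *\<^sub>v y) $ i
    = (\<Sum>j\<in>J. complex_of_real (c j) * (y \<bullet>c x j) * x j $ i)" (is "(?A *\<^sub>v y) $ i = _")
proof -
  have xd: "dim_vec (x j) = N" if "j \<in> J" for j using x[OF that] by simp
  have "(?A *\<^sub>v y) $ i = (\<Sum>t<N. (\<Sum>j\<in>J. complex_of_real (c j) * (x j $ i * cnj (x j $ t))) * y $ t)"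
    using y i xd by (subst mult_mat_vec_index[of _ N N]) (auto simp: mat_sum_def outer_prod_def intro!: sum.cong)
  also have "\<dots> = (\<Sum>j\<in>J. complex_of_real (c j) * (\<Sum>t<N. y $ t * cnj (x j $ t)) * x j $ i)"
    unfolding sum_distrib_left sum_distrib_right by (subst sum.swap) (simp add: mult_ac)
  also have "\<dots> = (\<Sum>j\<in>J. complex_of_real (c j) * (y \<bullet>c x j) * x j $ i)"
    by (intro sum.cong) (simp_all add: cscalar_prod_sum[OF x])
  finally show ?thesis .
qed

text \<open>The vectors are not normalized, hence the factor \<open>sq_norm_cvec (x l)\<close> in
  the eigenvalue. Zero vectors, which arise from outcomes of probability zero, satisfy the equation
  trivially.\<close>

lemma orthogonal_sum_eigenvector:
  assumes J: "finite J" and x: "\<And>j. j \<in> J \<Longrightarrow> x j \<in> carrier_vec N"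
    and orth: "\<And>i j. i \<in> J \<Longrightarrow> j \<in> J \<Longrightarrow> i \<noteq> j \<Longrightarrow> x i \<bullet>c x j = 0" and l: "l \<in> J"
  shows "mat_sum N (\<lambda>j. complex_of_real (c j) \<cdot>\<^sub>m outer_prod (x j) (x j)) J *\<^sub>v x l
    = complex_of_real (c l * sq_norm_cvec (x l)) \<cdot>\<^sub>v x l" (is "?A *\<^sub>v _ = _")
proof (rule eq_vecI)
  fix i assume "i < dim_vec (complex_of_real (c l * sq_norm_cvec (x l)) \<cdot>\<^sub>v x l)"
  then have i: "i < N" using x[OF l] by simp
  have "(?A *\<^sub>v x l) $ i = (\<Sum>j\<in>J. complex_of_real (c j) * (x l \<bullet>c x j) * x j $ i)"
    by (rule orthogonal_sum_apply[OF J x x[OF l] i])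
  also have "\<dots> = (\<Sum>j\<in>J. if j = l then complex_of_real (c l) * (x l \<bullet>c x l) * x l $ i else 0)"
    using orth[OF l] by (intro sum.cong) auto
  also have "\<dots> = complex_of_real (c l) * (x l \<bullet>c x l) * x l $ i" using J l by simp
  also have "\<dots> = (complex_of_real (c l * sq_norm_cvec (x l)) \<cdot>\<^sub>v x l) $ i"
    using i x[OF l] by (simp add: cscalar_prod_self)
  finally show "(?A *\<^sub>v x l) $ i = (complex_of_real (c l * sq_norm_cvec (x l)) \<cdot>\<^sub>v x l) $ i" .
qed (use x[OF l] in \<open>auto simp: mat_sum_def\<close>)

text \<open>The nonzero \<open>x j\<close>, normalized, extend to an orthonormal basis, and the
  added vectors lie in the kernel of \<open>A\<close>. A diagonalization has to be exhibited before
  the choice in \<open>mat_log2\<close> has its defining property.\<close>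

lemma orthogonal_sum_diagonalizable:
  fixes x :: "'j \<Rightarrow> complex vec"
  assumes J: "finite J" and x: "\<And>j. j \<in> J \<Longrightarrow> x j \<in> carrier_vec N"
    and orth: "\<And>i j. i \<in> J \<Longrightarrow> j \<in> J \<Longrightarrow> i \<noteq> j \<Longrightarrow> x i \<bullet>c x j = 0"
    and A: "A = mat_sum N (\<lambda>j. complex_of_real (c j) \<cdot>\<^sub>m outer_prod (x j) (x j)) J"
  shows "\<exists>U (d :: nat \<Rightarrow> real). U \<in> carrier_mat N N \<and> U * mat_adjoint U = 1\<^sub>m N \<and>
      A = U * mat_diag N (\<lambda>i. complex_of_real (d i)) * mat_adjoint U"
proof -
  have Ac: "A \<in> carrier_mat N N" by (simp add: A mat_sum_def)
  \<comment> \<open>Zero vectors cannot be normalized; they contribute nothing to \<open>A\<close>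
    and are left out of the family.\<close>
  define J' where "J' = {j \<in> J. x j \<noteq> 0\<^sub>v N}"
  obtain h where h: "bij_betw h {0..<card J'} J'"
    using ex_bij_betw_nat_finite[of J'] J by (auto simp: J'_def)
  let ?k = "card J'"
  have hJ: "h i \<in> J'" if "i < ?k" for i using h that by (auto simp: bij_betw_def)
  have hinj: "h i = h j \<longleftrightarrow> i = j" if "i < ?k" "j < ?k" for i j
    using h that by (auto simp: bij_betw_def inj_on_def)
  define r where "r j = complex_of_real (1 / sqrt (sq_norm_cvec (x j)))" for j
  define u where "u i = r (h i) \<cdot>\<^sub>v x (h i)" for i
  have pos: "sq_norm_cvec (x j) > 0" if "j \<in> J'" for j
    using that sq_norm_cvec_nonneg[of "x j"] sq_norm_cvec_eq_0[OF x, of j] by (simp add: J'_def)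
  have xh: "x (h i) \<in> carrier_vec N" if "i < ?k" for i using x hJ[OF that] by (simp add: J'_def)
  have fam: "orthonormal_family N ?k u"
    unfolding orthonormal_family_def
  proof (intro conjI allI impI)
    fix i assume "i < ?k" then show "u i \<in> carrier_vec N" using xh by (simp add: u_def)
  next
    fix i j assume ij: "i < ?k" "j < ?k"
    show "u i \<bullet>c u j = (if i = j then 1 else 0)"
    proof (cases "i = j")
      case True
      have "sq_norm_cvec (u i) = 1"
        using pos[OF hJ[OF ij(1)]] by (simp add: u_def sq_norm_cvec_smult r_def norm_divide power_divide)
      then show ?thesis using True by (simp only: cscalar_prod_self) simp
    next
      case False
      then have "x (h i) \<bullet>c x (h j) = 0" using orth hJ ij hinj by (auto simp: J'_def)
      then show ?thesis unfolding u_def using False xh ij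
        by (subst cscalar_prod_smult_left[of _ N], simp, simp)
          (subst cscalar_prod_smult_right[of _ N], auto)
    qed
  qed
  obtain v where v: "orthonormal_family N N v" and vu: "\<And>i. i < ?k \<Longrightarrow> v i = u i"
    using orthonormal_family_extend[OF fam] by blast
  have vc: "v l \<in> carrier_vec N" if "l < N" for l using v that by (auto simp: orthonormal_family_def)
  have kN: "?k \<le> N" by (rule orthonormal_family_le[OF fam])
  have "\<exists>d. A *\<^sub>v v l = complex_of_real d \<cdot>\<^sub>v v l" if l: "l < N" for l
  proof (cases "l < ?k")
    case True
    have hl: "h l \<in> J" using hJ[OF True] by (simp add: J'_def)
    have "A *\<^sub>v u l = r (h l) \<cdot>\<^sub>v (A *\<^sub>v x (h l))"
      unfolding u_def using Ac xh[OF True] by (rule mult_mat_vec)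
    also have "A *\<^sub>v x (h l) = complex_of_real (c (h l) * sq_norm_cvec (x (h l))) \<cdot>\<^sub>v x (h l)"
      unfolding A by (rule orthogonal_sum_eigenvector[OF J x orth hl])
    finally have "A *\<^sub>v u l = complex_of_real (c (h l) * sq_norm_cvec (x (h l))) \<cdot>\<^sub>v u l"
      by (simp add: u_def smult_smult_assoc mult_ac)
    then show ?thesis unfolding vu[OF True] by blast
  next
    case False
    have orth0: "v l \<bullet>c x j = 0" if j: "j \<in> J" for j
    proof (cases "x j = 0\<^sub>v N")
      case True
      then show ?thesis using vc[OF l] by simp
    next
      case False
      then have "j \<in> J'" using j by (simp add: J'_def)
      then obtain i where i: "i < ?k" "h i = j" using h by (force simp: bij_betw_def)
      have "v l \<bullet>c v i = 0" using v l i \<open>\<not> l < ?k\<close> kN by (auto simp: orthonormal_family_def)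
      then have "cnj (r j) * (v l \<bullet>c x j) = 0"
        using vu[OF i(1)] vc[OF l] xh[OF i(1)] i(2) cscalar_prod_smult_right[of "v l" N "x j" "r j"]
        by (simp add: u_def)
      moreover have "r j \<noteq> 0" using pos[OF \<open>j \<in> J'\<close>] by (simp add: r_def)
      ultimately show ?thesis by simp
    qed
    have "A *\<^sub>v v l = complex_of_real 0 \<cdot>\<^sub>v v l"
    proof (rule eq_vecI)
      fix i assume "i < dim_vec (complex_of_real 0 \<cdot>\<^sub>v v l)"
      then have i: "i < N" using vc[OF l] by simp
      show "(A *\<^sub>v v l) $ i = (complex_of_real 0 \<cdot>\<^sub>v v l) $ i"
        using orthogonal_sum_apply[OF J x vc[OF l] i, where c = c] orth0 i vc[OF l]
        by (simp add: A)
    qed (use Ac vc[OF l] in auto)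
    then show ?thesis by blast
  qed
  then obtain d where "\<And>l. l < N \<Longrightarrow> A *\<^sub>v v l = complex_of_real (d l) \<cdot>\<^sub>v v l" by metis
  then show ?thesis by (rule diagonalizable_if_orthonormal_eigenvectors[OF Ac v])
qed

text \<open>\<open>Tr (A L)\<close> is the weighted sum of the values \<open><x j, L x j>\<close>,
  so \<open>L\<close> is needed only on eigenvectors of \<open>A\<close>, where it is known. The
  weights \<open>c\<close> allow two uses: unit weights for the branches of a pure state, and
  outcome probabilities for the reduced state of a measured qubit.\<close>

lemma von_neumann_entropy_orthogonal_sum:
  fixes x :: "'j \<Rightarrow> complex vec"
  assumes J: "finite J" and x: "\<And>j. j \<in> J \<Longrightarrow> x j \<in> carrier_vec N"
    and orth: "\<And>i j. i \<in> J \<Longrightarrow> j \<in> J \<Longrightarrow> i \<noteq> j \<Longrightarrow> x i \<bullet>c x j = 0"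
    and A: "A = mat_sum N (\<lambda>j. complex_of_real (c j) \<cdot>\<^sub>m outer_prod (x j) (x j)) J"
  shows "von_neumann_entropy A =
    - (\<Sum>j\<in>J. c j * sq_norm_cvec (x j) * log 2 (c j * sq_norm_cvec (x j)))"
proof -
  have Ac: "A \<in> carrier_mat N N" by (simp add: A mat_sum_def)
  note ex = orthogonal_sum_diagonalizable[OF J x orth A]
  define L where "L = mat_log2 A"
  have L: "L \<in> carrier_mat N N" unfolding L_def by (rule mat_log2_eigenvector(1)[OF Ac ex])
  let ?q = "\<lambda>j. c j * sq_norm_cvec (x j)"
  have ev: "(\<Sum>s<N. L $$ (t, s) * x j $ s) = complex_of_real (log 2 (?q j)) * x j $ t"
    if j: "j \<in> J" and t: "t < N" for j t
  proof -
    have "L *\<^sub>v x j = complex_of_real (log 2 (?q j)) \<cdot>\<^sub>v x j"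
      unfolding L_def using x[OF j] orthogonal_sum_eigenvector[OF J x orth j, where c = c]
      by (intro mat_log2_eigenvector(2)[OF Ac ex]) (auto simp: A)
    then show ?thesis using mult_mat_vec_index[OF L x[OF j] t] x[OF j] t by simp
  qed
  have xd: "dim_vec (x j) = N" if "j \<in> J" for j using x[OF that] by simp
  have "mat_trace (A * L) = (\<Sum>s<N. \<Sum>t<N. A $$ (s, t) * L $$ (t, s))"
    unfolding mat_trace_def using Ac by (intro sum.cong mult_mat_index[OF Ac L]) auto
  also have "\<dots> = (\<Sum>s<N. \<Sum>t<N. (\<Sum>j\<in>J. complex_of_real (c j) * (x j $ s * cnj (x j $ t))) * L $$ (t, s))"
    using xd by (intro sum.cong refl) (auto simp: A mat_sum_def outer_prod_def intro!: sum.cong)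
  also have "\<dots> = (\<Sum>s<N. \<Sum>t<N. \<Sum>j\<in>J. complex_of_real (c j) * (cnj (x j $ t) * (L $$ (t, s) * x j $ s)))"
    by (simp add: sum_distrib_right sum_distrib_left mult_ac)
  also have "\<dots> = (\<Sum>s<N. \<Sum>j\<in>J. \<Sum>t<N. complex_of_real (c j) * (cnj (x j $ t) * (L $$ (t, s) * x j $ s)))"
    by (intro sum.cong refl sum.swap)
  also have "\<dots> = (\<Sum>j\<in>J. \<Sum>s<N. \<Sum>t<N. complex_of_real (c j) * (cnj (x j $ t) * (L $$ (t, s) * x j $ s)))"
    by (rule sum.swap)
  \<comment> \<open>The sum over \<open>s\<close> moves innermost, where it is the entry of
    \<open>L\<close> applied to \<open>x j\<close> that \<open>ev\<close> evaluates.\<close>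
  also have "\<dots> = (\<Sum>j\<in>J. \<Sum>t<N. \<Sum>s<N. complex_of_real (c j) * (cnj (x j $ t) * (L $$ (t, s) * x j $ s)))"
    by (intro sum.cong refl sum.swap)
  also have "\<dots> = (\<Sum>j\<in>J. \<Sum>t<N. complex_of_real (c j) * (cnj (x j $ t) * (complex_of_real (log 2 (?q j)) * x j $ t)))"
    by (intro sum.cong refl) (simp add: sum_distrib_left[symmetric] ev)
  also have "\<dots> = (\<Sum>j\<in>J. complex_of_real (c j) * complex_of_real (log 2 (?q j)) * (x j \<bullet>c x j))"
    using x by (intro sum.cong refl) (simp add: cscalar_prod_sum[of _ N] sum_distrib_left mult_ac)
  also have "\<dots> = complex_of_real (\<Sum>j\<in>J. ?q j * log 2 (?q j))"
    by (simp add: cscalar_prod_self mult_ac)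
  finally show ?thesis by (simp add: von_neumann_entropy_def L_def)
qed

section \<open>Binary digits and tensor products\<close>

lemma qubit_digit_less: "qubit_digit s k < 2"
  by (simp add: qubit_digit_def)

lemma qubit_digit_eq_bit: "qubit_digit s k = of_bool (bit s k)"
  by (simp add: qubit_digit_def bit_iff_odd mod2_eq_if)

text \<open>Below \<open>2 ^ n\<close> all digits from position \<open>n\<close> on are zero, so no
  further digit can differ.\<close>

lemma qubit_digits_eqI:
  assumes "r < 2 ^ n" "s < 2 ^ n" "\<And>l. l < n \<Longrightarrow> qubit_digit r l = qubit_digit s l"
  shows "r = s"
proof (rule bit_eqI)
  fix l
  have "\<not> bit x l" if "n \<le> l" "x < 2 ^ n" for x :: nat
  proof -
    have "x < 2 ^ l" using that by (meson less_le_trans one_le_numeral power_increasing)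
    then show ?thesis by (simp add: bit_iff_odd)
  qed
  moreover have "bit r l = bit s l" if "l < n"
    using assms(3)[OF that] unfolding qubit_digit_eq_bit of_bool_eq_iff .
  ultimately show "bit r l = bit s l"
    using assms(1,2) by (cases "l < n") auto
qed

text \<open>The left inverse of \<open>insert_digit k a\<close>: digits above position
  \<open>k\<close> move down by one. Together with \<open>qubit_digit\<close> it recovers both
  components of an index.\<close>

definition remove_digit :: "nat \<Rightarrow> nat \<Rightarrow> nat" where
  "remove_digit k s = s mod 2 ^ k + (s div 2 ^ (k + 1)) * 2 ^ k"

lemma insert_digit_div: "a < 2 \<Longrightarrow> insert_digit k a r div 2 ^ k = a + 2 * (r div 2 ^ k)"
proof -
  have "insert_digit k a r = r mod 2 ^ k + (a + 2 * (r div 2 ^ k)) * 2 ^ k"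
    by (simp add: insert_digit_def algebra_simps)
  then show ?thesis by (simp del: add_mult_distrib mult.commute)
qed

lemma insert_digit_mod: "insert_digit k a r mod 2 ^ k = r mod 2 ^ k"
proof -
  have "insert_digit k a r = r mod 2 ^ k + (a + 2 * (r div 2 ^ k)) * 2 ^ k"
    by (simp add: insert_digit_def algebra_simps)
  then show ?thesis by simp
qed

lemma remove_insert_digit: "a < 2 \<Longrightarrow> remove_digit k (insert_digit k a r) = r"
  using mod_div_mult_eq[of r "2 ^ k"]
  by (simp add: remove_digit_def insert_digit_mod insert_digit_div div_mult2_eq[of _ "2 ^ k" 2]
      mult.commute[of 2] del: mult.commute)

lemma insert_remove_digit: "insert_digit k (qubit_digit s k) (remove_digit k s) = s"
proof -
  have "remove_digit k s mod 2 ^ k = s mod 2 ^ k" "remove_digit k s div 2 ^ k = s div 2 ^ k div 2"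
    by (simp_all add: remove_digit_def mult.commute[of 2] div_mult2_eq)
  then have "insert_digit k (qubit_digit s k) (remove_digit k s)
      = s mod 2 ^ k + (s div 2 ^ k mod 2 + 2 * (s div 2 ^ k div 2)) * 2 ^ k"
    unfolding insert_digit_def qubit_digit_def add_mult_distrib by simp
  also have "s div 2 ^ k mod 2 + 2 * (s div 2 ^ k div 2) = s div 2 ^ k" by simp
  also have "s mod 2 ^ k + s div 2 ^ k * 2 ^ k = s" by (rule mod_div_mult_eq)
  finally show ?thesis .
qed

lemma qubit_digit_insert_same: "a < 2 \<Longrightarrow> qubit_digit (insert_digit k a r) k = a"
  by (simp add: qubit_digit_def insert_digit_div)

lemma qubit_digit_insert_below:
  assumes "l < k"
  shows "qubit_digit (insert_digit k a r) l = qubit_digit r l"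
proof -
  have "bit (take_bit k (insert_digit k a r)) l = bit (take_bit k r) l"
    by (simp only: take_bit_eq_mod insert_digit_mod)
  then show ?thesis using assms by (simp add: qubit_digit_eq_bit bit_take_bit_iff)
qed

lemma qubit_digit_insert_above:
  assumes "a < 2" "k \<le> l"
  shows "qubit_digit (insert_digit k a r) (Suc l) = qubit_digit r l"
proof -
  obtain d where l: "l = k + d" using assms(2) le_Suc_ex by blast
  have "insert_digit k a r div 2 ^ Suc l = insert_digit k a r div 2 ^ k div 2 div 2 ^ d"
    by (simp add: l power_add div_mult2_eq[symmetric] mult_ac)
  also have "\<dots> = r div 2 ^ l"
    using assms by (simp add: insert_digit_div l power_add div_mult2_eq)
  finally show ?thesis by (simp only: qubit_digit_def)
qed

lemma insert_digit_less:
  assumes "k \<le> n" "a < 2" "r < 2 ^ n"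
  shows "insert_digit k a r < 2 ^ Suc n"
proof -
  obtain d where n: "n = k + d" using assms(1) le_Suc_ex by blast
  have "r div 2 ^ k < 2 ^ d" using assms(3) by (simp add: n power_add less_mult_imp_div_less mult.commute)
  then have "a + 2 * (r div 2 ^ k) < 2 ^ Suc d" using assms(2) by simp
  then have "insert_digit k a r div 2 ^ k < 2 ^ Suc d" using assms(2) by (simp only: insert_digit_div)
  then have "insert_digit k a r < 2 ^ Suc d * 2 ^ k" by (simp add: div_less_iff_less_mult)
  then show ?thesis by (simp add: n power_add mult_ac)
qed

lemma remove_digit_less:
  assumes "k \<le> n" "s < 2 ^ Suc n"
  shows "remove_digit k s < 2 ^ n"
proof -
  obtain d where n: "n = k + d" using assms(1) le_Suc_ex by blast
  have "s div 2 ^ (k + 1) < 2 ^ d"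
    using assms(2) by (simp add: n power_add less_mult_imp_div_less mult_ac)
  then have "s div 2 ^ (k + 1) + 1 \<le> 2 ^ d" by simp
  then have "(s div 2 ^ (k + 1) + 1) * 2 ^ k \<le> 2 ^ k * 2 ^ d"
    using mult_le_mono2[of _ "2 ^ d" "2 ^ k"] by (simp only: mult.commute[of _ "2 ^ k"])
  moreover have "s mod 2 ^ k < 2 ^ k" by simp
  ultimately show ?thesis unfolding remove_digit_def n power_add add_mult_distrib by linarith
qed

text \<open>Inserting a digit at \<open>k\<close> is a bijection from pairs of a remainder and a
  digit to indices. This splitting makes partial traces and operators on a single qubit computable
  in entries.\<close>

lemma sum_insert_digit:
  assumes "k < n"
  shows "(\<Sum>s<2 ^ n. g s) = (\<Sum>r<2 ^ (n - 1). \<Sum>a<2. g (insert_digit k a r))"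
proof -
  obtain m where n: "n = Suc m" using assms by (cases n) auto
  have less: "insert_digit k a r < 2 ^ Suc m" if "a < 2" "r < 2 ^ m" for a r
    using insert_digit_less[of k m] that assms by (simp add: n)
  have "(\<Sum>s<2 ^ Suc m. g s) = (\<Sum>(r, a)\<in>{..<2 ^ m} \<times> {..<2}. g (insert_digit k a r))"
    by (rule sum.reindex_bij_witness[of _ "\<lambda>(r, a). insert_digit k a r" "\<lambda>s. (remove_digit k s, qubit_digit s k)"])
      (use assms in \<open>auto simp: n insert_remove_digit remove_insert_digit qubit_digit_less
         qubit_digit_insert_same remove_digit_less less[simplified]\<close>)
  then show ?thesis by (simp add: n sum.cartesian_product)
qed

text \<open>Distributivity, by splitting off the highest digit. The product formulas for tensor
  products below all come down to this exchange.\<close>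

lemma sum_prod_qubit_digits:
  fixes f :: "nat \<Rightarrow> nat \<Rightarrow> 'a :: comm_semiring_1"
  shows "(\<Sum>s<2 ^ n. \<Prod>k<n. f k (qubit_digit s k)) = (\<Prod>k<n. \<Sum>a<2. f k a)"
proof (induction n)
  case (Suc n)
  have "(\<Sum>s<2 ^ Suc n. \<Prod>k<Suc n. f k (qubit_digit s k))
      = (\<Sum>r<2 ^ n. \<Sum>a<2. (\<Prod>k<n. f k (qubit_digit r k)) * f n a)"
    by (subst sum_insert_digit[of n])
      (auto intro!: sum.cong prod.cong simp: qubit_digit_insert_same qubit_digit_insert_below)
  also have "\<dots> = (\<Sum>r<2 ^ n. \<Prod>k<n. f k (qubit_digit r k)) * (\<Sum>a<2. f n a)"
    by (simp add: sum_product)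
  finally show ?case by (simp add: Suc.IH)
qed simp

section \<open>Products and inner products of tensors\<close>

lemma tensor_mat_carrier [simp]: "tensor_mat n M \<in> carrier_mat (2 ^ n) (2 ^ n)"
  by (simp add: tensor_mat_def)

lemma tensor_vec_carrier [simp]: "tensor_vec n v \<in> carrier_vec (2 ^ n)"
  by (simp add: tensor_vec_def)

lemma tensor_mat_mult_vec:
  assumes "\<And>k. k < n \<Longrightarrow> M k \<in> carrier_mat 2 2" "\<And>k. k < n \<Longrightarrow> v k \<in> carrier_vec 2"
  shows "tensor_mat n M *\<^sub>v tensor_vec n v = tensor_vec n (\<lambda>k. M k *\<^sub>v v k)"
proof (rule eq_vecI)
  fix s assume "s < dim_vec (tensor_vec n (\<lambda>k. M k *\<^sub>v v k))"
  then have s: "s < 2 ^ n" by (simp add: tensor_vec_def)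
  have "(tensor_mat n M *\<^sub>v tensor_vec n v) $ s
      = (\<Sum>t<2 ^ n. tensor_mat n M $$ (s, t) * tensor_vec n v $ t)"
    using s by (intro mult_mat_vec_index) auto
  also have "\<dots> = (\<Sum>t<2 ^ n. \<Prod>k<n. M k $$ (qubit_digit s k, qubit_digit t k) * v k $ qubit_digit t k)"
    using s by (simp add: tensor_mat_def tensor_vec_def prod.distrib)
  also have "\<dots> = (\<Prod>k<n. \<Sum>a<2. M k $$ (qubit_digit s k, a) * v k $ a)"
    by (rule sum_prod_qubit_digits)
  also have "\<dots> = (\<Prod>k<n. (M k *\<^sub>v v k) $ qubit_digit s k)"
    using assms by (intro prod.cong refl) (simp add: mult_mat_vec_index[of _ 2 2] qubit_digit_less)
  finally show "(tensor_mat n M *\<^sub>v tensor_vec n v) $ s = tensor_vec n (\<lambda>k. M k *\<^sub>v v k) $ s"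
    using s by (simp add: tensor_vec_def)
qed (simp add: tensor_mat_def tensor_vec_def)

lemma tensor_mat_mult:
  assumes "\<And>k. k < n \<Longrightarrow> M k \<in> carrier_mat 2 2" "\<And>k. k < n \<Longrightarrow> M' k \<in> carrier_mat 2 2"
  shows "tensor_mat n M * tensor_mat n M' = tensor_mat n (\<lambda>k. M k * M' k)"
proof (rule eq_matI)
  fix s t assume "s < dim_row (tensor_mat n (\<lambda>k. M k * M' k))" "t < dim_col (tensor_mat n (\<lambda>k. M k * M' k))"
  then have s: "s < 2 ^ n" and t: "t < 2 ^ n" by (auto simp: tensor_mat_def)
  have "(tensor_mat n M * tensor_mat n M') $$ (s, t)
      = (\<Sum>r<2 ^ n. tensor_mat n M $$ (s, r) * tensor_mat n M' $$ (r, t))"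
    using s t by (intro mult_mat_index) auto
  also have "\<dots> = (\<Sum>r<2 ^ n. \<Prod>k<n. M k $$ (qubit_digit s k, qubit_digit r k) * M' k $$ (qubit_digit r k, qubit_digit t k))"
    using s t by (simp add: tensor_mat_def prod.distrib)
  also have "\<dots> = (\<Prod>k<n. \<Sum>a<2. M k $$ (qubit_digit s k, a) * M' k $$ (a, qubit_digit t k))"
    by (rule sum_prod_qubit_digits)
  also have "\<dots> = (\<Prod>k<n. (M k * M' k) $$ (qubit_digit s k, qubit_digit t k))"
    using assms by (intro prod.cong refl mult_mat_index[of _ 2 2 _ 2, symmetric]) (auto simp: qubit_digit_less)
  finally show "(tensor_mat n M * tensor_mat n M') $$ (s, t) = tensor_mat n (\<lambda>k. M k * M' k) $$ (s, t)"
    using s t by (simp add: tensor_mat_def)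
qed (simp_all add: tensor_mat_def)

lemma tensor_vec_cscalar_prod:
  assumes "\<And>k. k < n \<Longrightarrow> v k \<in> carrier_vec 2" "\<And>k. k < n \<Longrightarrow> w k \<in> carrier_vec 2"
  shows "tensor_vec n v \<bullet>c tensor_vec n w = (\<Prod>k<n. v k \<bullet>c w k)"
proof -
  have "tensor_vec n v \<bullet>c tensor_vec n w
      = (\<Sum>s<2 ^ n. \<Prod>k<n. v k $ qubit_digit s k * cnj (w k $ qubit_digit s k))"
    by (simp add: cscalar_prod_sum[of _ "2 ^ n"]) (simp add: tensor_vec_def prod.distrib)
  also have "\<dots> = (\<Prod>k<n. \<Sum>a<2. v k $ a * cnj (w k $ a))"
    by (rule sum_prod_qubit_digits)
  also have "\<dots> = (\<Prod>k<n. v k \<bullet>c w k)"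
    using assms by (intro prod.cong refl cscalar_prod_sum[symmetric]) auto
  finally show ?thesis .
qed

text \<open>Away from site \<open>k\<close> all factors are entries of the identity, and their
  product is a Kronecker delta in the remaining digits.\<close>

lemma site_projector_insert_digit:
  assumes k: "k < n" and v: "v \<in> carrier_vec 2" and ab: "a < 2" "b < 2"
    and rs: "r < 2 ^ (n - 1)" "s < 2 ^ (n - 1)"
  shows "site_projector n k v $$ (insert_digit k a r, insert_digit k b s)
    = (if r = s then v $ a * cnj (v $ b) else 0)"
proof -
  let ?s = "insert_digit k a r" and ?t = "insert_digit k b s"
  let ?f = "\<lambda>l. (if l = k then outer_prod v v else 1\<^sub>m 2) $$ (qubit_digit ?s l, qubit_digit ?t l)"
  have less: "?s < 2 ^ n" "?t < 2 ^ n"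
    using insert_digit_less[of k "n - 1"] k ab rs by auto
  have "site_projector n k v $$ (?s, ?t) = (\<Prod>l<n. ?f l)"
    using less by (simp add: site_projector_def tensor_mat_def)
  also have "\<dots> = ?f k * (\<Prod>l\<in>{..<n} - {k}. ?f l)"
    using k by (intro prod.remove) auto
  also have "?f k = v $ a * cnj (v $ b)"
    using ab v by (simp add: qubit_digit_insert_same outer_prod_def)
  also have "(\<Prod>l\<in>{..<n} - {k}. ?f l) = (if r = s then 1 else 0)"
  proof (cases "r = s")
    case True
    have "qubit_digit ?s l = qubit_digit ?t l" if "l \<noteq> k" for l
      using that ab qubit_digit_insert_below[of l k] qubit_digit_insert_above[of _ k "l - 1"] True
      by (cases "l < k") auto
    then show ?thesis using True by (auto intro!: prod.neutral simp: qubit_digit_less)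
  next
    case False
    then obtain l where l: "l < n - 1" "qubit_digit r l \<noteq> qubit_digit s l"
      using qubit_digits_eqI rs by blast
    \<comment> \<open>A digit of the remainder at or above position \<open>k\<close> sits one place
      higher in the full index.\<close>
    define l' where "l' = (if l < k then l else Suc l)"
    have "qubit_digit ?s l' \<noteq> qubit_digit ?t l'" "l' \<noteq> k" "l' < n"
      using l ab by (auto simp: l'_def qubit_digit_insert_below qubit_digit_insert_above)
    then show ?thesis using False by (auto intro!: prod_zero bexI[of _ l'] simp: qubit_digit_less)
  qed
  finally show ?thesis by simp
qed

section \<open>Local measurements of a pure state\<close>

definition hermitian_mat :: "nat \<Rightarrow> complex mat \<Rightarrow> bool" where
  "hermitian_mat N P \<longleftrightarrow> P \<in> carrier_mat N N \<and> (\<forall>s<N. \<forall>t<N. cnj (P $$ (t, s)) = P $$ (s, t))"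

lemma outer_prod_carrier: "v \<in> carrier_vec N \<Longrightarrow> outer_prod v v \<in> carrier_mat N N"
  by (auto simp: outer_prod_def)

lemma outer_prod_mult_vec:
  assumes "v \<in> carrier_vec N" "x \<in> carrier_vec N"
  shows "outer_prod v v *\<^sub>v x = (x \<bullet>c v) \<cdot>\<^sub>v v"
proof (rule eq_vecI)
  fix i assume "i < dim_vec ((x \<bullet>c v) \<cdot>\<^sub>v v)"
  then have i: "i < N" using assms by simp
  have "(outer_prod v v *\<^sub>v x) $ i = (\<Sum>j<N. v $ i * cnj (v $ j) * x $ j)"
    using assms i by (subst mult_mat_vec_index[OF outer_prod_carrier]) (auto simp: outer_prod_def)
  also have "\<dots> = (x \<bullet>c v) * v $ i"
    unfolding cscalar_prod_sum[OF assms(1)] sum_distrib_right by (intro sum.cong) auto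
  finally show "(outer_prod v v *\<^sub>v x) $ i = ((x \<bullet>c v) \<cdot>\<^sub>v v) $ i" using i assms by simp
qed (use assms in \<open>auto simp: outer_prod_def\<close>)

lemma hermitian_mat_tensor:
  assumes "\<And>k. k < n \<Longrightarrow> hermitian_mat 2 (M k)"
  shows "hermitian_mat (2 ^ n) (tensor_mat n M)"
  unfolding hermitian_mat_def
proof (intro conjI allI impI)
  fix s t :: nat assume "s < 2 ^ n" "t < 2 ^ n"
  then show "cnj (tensor_mat n M $$ (t, s)) = tensor_mat n M $$ (s, t)"
    using assms by (auto simp: tensor_mat_def hermitian_mat_def qubit_digit_less intro!: prod.cong)
qed simp

lemma hermitian_mat_outer_prod: "v \<in> carrier_vec N \<Longrightarrow> hermitian_mat N (outer_prod v v)"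
  by (auto simp: hermitian_mat_def outer_prod_def)

lemma hermitian_mat_one: "hermitian_mat N (1\<^sub>m N)"
  by (auto simp: hermitian_mat_def)

lemma hermitian_mat_mult_vec_cscalar_prod:
  assumes P: "hermitian_mat N P" and x: "x \<in> carrier_vec N" and y: "y \<in> carrier_vec N"
  shows "(P *\<^sub>v x) \<bullet>c y = x \<bullet>c (P *\<^sub>v y)"
proof -
  have Pc: "P \<in> carrier_mat N N" using P by (simp add: hermitian_mat_def)
  have Py: "P *\<^sub>v y \<in> carrier_vec N" using Pc y by auto
  have "(P *\<^sub>v x) \<bullet>c y = (\<Sum>i<N. \<Sum>j<N. P $$ (i, j) * x $ j * cnj (y $ i))"
    unfolding cscalar_prod_sum[OF y]
    by (intro sum.cong refl) (simp add: mult_mat_vec_index[OF Pc x] sum_distrib_right del: index_mult_mat_vec)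
  also have "\<dots> = (\<Sum>j<N. \<Sum>i<N. x $ j * cnj (P $$ (j, i) * y $ i))"
    using P by (subst sum.swap) (auto simp: hermitian_mat_def intro!: sum.cong)
  also have "\<dots> = x \<bullet>c (P *\<^sub>v y)"
    unfolding cscalar_prod_sum[OF Py]
    by (intro sum.cong refl) (simp add: mult_mat_vec_index[OF Pc y] sum_distrib_left del: index_mult_mat_vec)
  finally show ?thesis .
qed

lemma mat_sum_outer_prod_index:
  assumes "\<And>j. j \<in> J \<Longrightarrow> x j \<in> carrier_vec N" "s < N" "t < N"
  shows "mat_sum N (\<lambda>j. outer_prod (x j) (x j)) J $$ (s, t) = (\<Sum>j\<in>J. x j $ s * cnj (x j $ t))"
proof -
  have "dim_vec (x j) = N" if "j \<in> J" for j using assms(1)[OF that] by simp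
  then show ?thesis using assms(2,3) by (auto simp: mat_sum_def outer_prod_def intro!: sum.cong)
qed

lemma hermitian_mat_sum_outer_prod:
  assumes "\<And>j. j \<in> J \<Longrightarrow> x j \<in> carrier_vec N"
  shows "hermitian_mat N (mat_sum N (\<lambda>j. outer_prod (x j) (x j)) J)"
  unfolding hermitian_mat_def
  using mat_sum_outer_prod_index[of J x N, OF assms] by (auto simp: mat_sum_def[of N] mult.commute)

text \<open>Hermiticity turns the right factor \<open>P\<close> into the complex conjugate of the
  left one, so both act on \<open>x j\<close>. The form with a sum is needed for states already
  measured on other qubits.\<close>

lemma hermitian_sandwich_sum_outer_prod:
  assumes P: "hermitian_mat N P" and x: "\<And>j. j \<in> J \<Longrightarrow> x j \<in> carrier_vec N"
  shows "P * mat_sum N (\<lambda>j. outer_prod (x j) (x j)) J * P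
    = mat_sum N (\<lambda>j. outer_prod (P *\<^sub>v x j) (P *\<^sub>v x j)) J" (is "P * ?A * P = ?B")
proof (rule eq_matI)
  have Pc: "P \<in> carrier_mat N N" using P by (simp add: hermitian_mat_def)
  have A: "?A \<in> carrier_mat N N" and B: "?B \<in> carrier_mat N N" by (auto simp: mat_sum_def)
  have PA: "P * ?A \<in> carrier_mat N N" using Pc A by auto
  have Px: "P *\<^sub>v x j \<in> carrier_vec N" if "j \<in> J" for j using Pc x[OF that] by auto
  show "dim_row (P * ?A * P) = dim_row ?B" "dim_col (P * ?A * P) = dim_col ?B" using Pc B by auto
  fix s t assume "s < dim_row ?B" "t < dim_col ?B"
  then have s: "s < N" and t: "t < N" using B by auto
  have herm: "cnj (P $$ (t, b)) = P $$ (b, t)" if "b < N" for b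
    using P t that by (simp add: hermitian_mat_def)
  have "(P * ?A * P) $$ (s, t) = (\<Sum>b<N. (P * ?A) $$ (s, b) * P $$ (b, t))"
    by (rule mult_mat_index[OF PA Pc s t])
  also have "\<dots> = (\<Sum>b<N. (\<Sum>a<N. P $$ (s, a) * (\<Sum>j\<in>J. x j $ a * cnj (x j $ b))) * P $$ (b, t))"
    by (intro sum.cong refl arg_cong2[of _ _ _ _ "(*)"])
      (simp add: mult_mat_index[OF Pc A s] mat_sum_outer_prod_index[OF x] del: index_mult_mat)
  also have "\<dots> = (\<Sum>b<N. \<Sum>a<N. \<Sum>j\<in>J. P $$ (s, a) * x j $ a * (cnj (x j $ b) * P $$ (b, t)))"
    by (simp add: sum_distrib_left sum_distrib_right mult_ac)
  also have "\<dots> = (\<Sum>b<N. \<Sum>j\<in>J. \<Sum>a<N. P $$ (s, a) * x j $ a * (cnj (x j $ b) * P $$ (b, t)))"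
    by (intro sum.cong refl sum.swap)
  also have "\<dots> = (\<Sum>j\<in>J. \<Sum>b<N. \<Sum>a<N. P $$ (s, a) * x j $ a * (cnj (x j $ b) * P $$ (b, t)))"
    by (rule sum.swap)
  also have "\<dots> = (\<Sum>j\<in>J. \<Sum>b<N. (P *\<^sub>v x j) $ s * (cnj (x j $ b) * P $$ (b, t)))"
    by (intro sum.cong refl) (simp add: mult_mat_vec_index[OF Pc x s] sum_distrib_right del: index_mult_mat_vec)
  also have "\<dots> = (\<Sum>j\<in>J. (P *\<^sub>v x j) $ s * cnj ((P *\<^sub>v x j) $ t))"
    by (intro sum.cong refl)
      (simp add: mult_mat_vec_index[OF Pc x t] sum_distrib_left herm mult_ac del: index_mult_mat_vec)
  also have "\<dots> = ?B $$ (s, t)" by (rule mat_sum_outer_prod_index[OF Px s t, symmetric])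
  finally show "(P * ?A * P) $$ (s, t) = ?B $$ (s, t)" .
qed

lemma outer_prod_eq_mat_sum:
  "v \<in> carrier_vec N \<Longrightarrow> outer_prod v v = mat_sum N (\<lambda>_. outer_prod v v) {()}"
  by (rule eq_matI) (auto simp: mat_sum_def outer_prod_def)

lemma hermitian_sandwich_outer_prod:
  assumes "hermitian_mat N P" "v \<in> carrier_vec N"
  shows "P * outer_prod v v * P = outer_prod (P *\<^sub>v v) (P *\<^sub>v v)"
proof -
  have "P *\<^sub>v v \<in> carrier_vec N" using assms by (auto simp: hermitian_mat_def)
  then show ?thesis
    using hermitian_sandwich_sum_outer_prod[OF assms(1), of "{()}" "\<lambda>_. v"] assms(2)
    by (simp flip: outer_prod_eq_mat_sum)
qed

lemma orthonormal_basis_carrier: "orthonormal_basis d u \<Longrightarrow> j < d \<Longrightarrow> u j \<in> carrier_vec d"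
  by (simp add: orthonormal_basis_def)

lemma orthonormal_basis_cscalar_prod:
  "orthonormal_basis d u \<Longrightarrow> i < d \<Longrightarrow> j < d \<Longrightarrow> u i \<bullet>c u j = (if i = j then 1 else 0)"
  by (simp add: orthonormal_basis_def)

lemma hermitian_mat_site_projector:
  "v \<in> carrier_vec 2 \<Longrightarrow> hermitian_mat (2 ^ n) (site_projector n k v)"
  unfolding site_projector_def
  by (rule hermitian_mat_tensor) (simp add: hermitian_mat_outer_prod hermitian_mat_one)

lemma site_projector_carrier: "site_projector n k v \<in> carrier_mat (2 ^ n) (2 ^ n)"
  by (simp add: site_projector_def)

lemma first_projector_carrier: "first_projector n m b j \<in> carrier_mat (2 ^ n) (2 ^ n)"
  by (simp add: first_projector_def)

lemma hermitian_mat_first_projector: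
  assumes "\<forall>k<m. orthonormal_basis 2 (b k)" "j \<in> {..<m} \<rightarrow>\<^sub>E {..<2}"
  shows "hermitian_mat (2 ^ n) (first_projector n m b j)"
proof -
  have "b k (j k) \<in> carrier_vec 2" if "k < m" for k
    using assms that by (intro orthonormal_basis_carrier) auto
  then show ?thesis unfolding first_projector_def
    by (intro hermitian_mat_tensor) (simp add: hermitian_mat_outer_prod hermitian_mat_one)
qed

lemma tensor_mat_cong: "(\<And>k. k < n \<Longrightarrow> M k = M' k) \<Longrightarrow> tensor_mat n M = tensor_mat n M'"
  by (auto simp: tensor_mat_def intro!: eq_matI prod.cong)

lemma tensor_vec_cong: "(\<And>k. k < n \<Longrightarrow> v k = v' k) \<Longrightarrow> tensor_vec n v = tensor_vec n v'"
  by (auto simp: tensor_vec_def intro!: eq_vecI prod.cong)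

text \<open>At every site at least one of the two factors is the identity. The update form
  \<open>b(m := u)\<close>, \<open>j(m := a)\<close> is what allows measuring one qubit at a
  time.\<close>

lemma site_projector_mult_first_projector:
  assumes b: "\<forall>k<m. orthonormal_basis 2 (b k)" and u: "orthonormal_basis 2 u"
    and j: "j \<in> {..<m} \<rightarrow>\<^sub>E {..<2}" and a: "a < 2"
  shows "site_projector n m (u a) * first_projector n m b j
    = first_projector n (Suc m) (b(m := u)) (j(m := a))"
proof -
  have bc: "outer_prod (b k (j k)) (b k (j k)) \<in> carrier_mat 2 2" if "k < m" for k
    using b j that by (intro outer_prod_carrier orthonormal_basis_carrier) auto
  have uc: "outer_prod (u a) (u a) \<in> carrier_mat 2 2"
    using u a by (intro outer_prod_carrier orthonormal_basis_carrier)
  show ?thesis unfolding site_projector_def first_projector_def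
    using bc uc left_mult_one_mat[OF bc] right_mult_one_mat[OF uc]
    by (subst tensor_mat_mult) (auto intro!: tensor_mat_cong)
qed

text \<open>The unnormalized state after the outcome tuple \<open>j\<close>; for a unit vector
  \<open>\<psi>\<close> its squared norm is the probability of that tuple.\<close>

definition branch :: "nat \<Rightarrow> nat \<Rightarrow> (nat \<Rightarrow> nat \<Rightarrow> complex vec) \<Rightarrow> complex vec \<Rightarrow> (nat \<Rightarrow> nat) \<Rightarrow> complex vec" where
  "branch n m b \<psi> j = first_projector n m b j *\<^sub>v \<psi>"

lemma branch_carrier: "branch n m b \<psi> j \<in> carrier_vec (2 ^ n)"
  unfolding branch_def by (rule carrier_vecI) (use first_projector_carrier[of n m b j] in simp)

lemma tensor_mat_zero_factor:
  "k < n \<Longrightarrow> M k = 0\<^sub>m 2 2 \<Longrightarrow> tensor_mat n M = 0\<^sub>m (2 ^ n) (2 ^ n)"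
  by (rule eq_matI) (auto simp: tensor_mat_def qubit_digit_less intro!: prod_zero bexI[of _ k])

lemma outer_prod_mult_outer_prod_orthogonal:
  assumes v: "v \<in> carrier_vec N" and w: "w \<in> carrier_vec N" and orth: "w \<bullet>c v = 0"
  shows "outer_prod v v * outer_prod w w = 0\<^sub>m N N"
proof (rule eq_matI)
  fix s t assume "s < dim_row (0\<^sub>m N N)" "t < dim_col (0\<^sub>m N N)"
  then have s: "s < N" and t: "t < N" by auto
  have "(outer_prod v v * outer_prod w w) $$ (s, t) = (\<Sum>k<N. (v $ s * cnj (v $ k)) * (w $ k * cnj (w $ t)))"
    unfolding mult_mat_index[OF outer_prod_carrier[OF v] outer_prod_carrier[OF w] s t]
    using v w s t by (intro sum.cong) (auto simp: outer_prod_def)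
  also have "\<dots> = v $ s * cnj (w $ t) * (w \<bullet>c v)"
    unfolding cscalar_prod_sum[OF v] sum_distrib_left by (intro sum.cong) auto
  finally show "(outer_prod v v * outer_prod w w) $$ (s, t) = 0\<^sub>m N N $$ (s, t)"
    using orth s t by simp
qed (use v w in \<open>auto simp: outer_prod_def\<close>)

text \<open>Distinct tuples differ at some measured site, where the two rank-one factors multiply to
  zero; one zero tensor factor annihilates the whole product of projectors. Hermiticity brings both
  projectors to the same side of the inner product.\<close>

lemma branch_orthogonal:
  assumes m: "m \<le> n" and b: "\<forall>k<m. orthonormal_basis 2 (b k)"
    and i: "i \<in> {..<m} \<rightarrow>\<^sub>E {..<2}" and j: "j \<in> {..<m} \<rightarrow>\<^sub>E {..<2}" and ij: "i \<noteq> j"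
    and psi: "\<psi> \<in> carrier_vec (2 ^ n)"
  shows "branch n m b \<psi> i \<bullet>c branch n m b \<psi> j = 0"
proof -
  obtain k where k: "k < m" "i k \<noteq> j k" using PiE_ext[OF i j] ij by auto
  have dig: "i l < 2" "j l < 2" if "l < m" for l using i j that by auto
  have bc: "b l (i l) \<in> carrier_vec 2" "b l (j l) \<in> carrier_vec 2" if "l < m" for l
    using b dig that by (auto intro: orthonormal_basis_carrier)
  have z: "outer_prod (b k (i k)) (b k (i k)) * outer_prod (b k (j k)) (b k (j k)) = 0\<^sub>m 2 2"
    using b bc k dig
    by (intro outer_prod_mult_outer_prod_orthogonal) (auto simp: orthonormal_basis_cscalar_prod)
  have PP: "first_projector n m b i * first_projector n m b j = 0\<^sub>m (2 ^ n) (2 ^ n)"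
    unfolding first_projector_def
  proof (subst tensor_mat_mult)
    show "tensor_mat n (\<lambda>l. (if l < m then outer_prod (b l (i l)) (b l (i l)) else 1\<^sub>m 2) *
         (if l < m then outer_prod (b l (j l)) (b l (j l)) else 1\<^sub>m 2)) = 0\<^sub>m (2 ^ n) (2 ^ n)"
      using k m z by (intro tensor_mat_zero_factor[of k]) auto
  qed (use bc in \<open>auto intro: outer_prod_carrier\<close>)
  have zero: "0\<^sub>m (2 ^ n) (2 ^ n) *\<^sub>v \<psi> = 0\<^sub>v (2 ^ n)"
    by (rule eq_vecI) (use psi in auto)
  have "branch n m b \<psi> i \<bullet>c branch n m b \<psi> j
      = \<psi> \<bullet>c (first_projector n m b i *\<^sub>v (first_projector n m b j *\<^sub>v \<psi>))"
    unfolding branch_def[of n m b \<psi> i]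
    using hermitian_mat_mult_vec_cscalar_prod[OF hermitian_mat_first_projector[OF b i] psi branch_carrier]
    by (simp add: branch_def)
  also have "first_projector n m b i *\<^sub>v (first_projector n m b j *\<^sub>v \<psi>) = 0\<^sub>v (2 ^ n)"
    using psi PP zero assoc_mult_mat_vec[OF first_projector_carrier first_projector_carrier psi, of m b i m b j]
    by simp
  finally show ?thesis using psi by simp
qed

lemma measure_first_outer_prod:
  assumes b: "\<forall>k<m. orthonormal_basis 2 (b k)" and psi: "\<psi> \<in> carrier_vec (2 ^ n)"
  shows "measure_first n m b (outer_prod \<psi> \<psi>) =
    mat_sum (2 ^ n) (\<lambda>j. outer_prod (branch n m b \<psi> j) (branch n m b \<psi> j)) ({..<m} \<rightarrow>\<^sub>E {..<2})"
  unfolding measure_first_def mat_sum_def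
  by (intro arg_cong[of _ _ "mat _ _"] ext)
    (auto intro!: sum.cong
      simp: branch_def hermitian_sandwich_outer_prod[OF hermitian_mat_first_projector[OF b] psi])

definition entropy_term :: "real \<Rightarrow> real" where
  "entropy_term x = - (x * log 2 x)"

definition branch_entropy :: "nat \<Rightarrow> nat \<Rightarrow> (nat \<Rightarrow> nat \<Rightarrow> complex vec) \<Rightarrow> complex vec \<Rightarrow> real" where
  "branch_entropy n m b \<psi> =
     (\<Sum>j\<in>{..<m} \<rightarrow>\<^sub>E {..<2}. entropy_term (sq_norm_cvec (branch n m b \<psi> j)))"

lemma von_neumann_entropy_measure_first:
  assumes m: "m \<le> n" and b: "\<forall>k<m. orthonormal_basis 2 (b k)" and psi: "\<psi> \<in> carrier_vec (2 ^ n)"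
  shows "von_neumann_entropy (measure_first n m b (outer_prod \<psi> \<psi>)) = branch_entropy n m b \<psi>"
proof -
  have one: "complex_of_real 1 \<cdot>\<^sub>m A = A" for A by (rule eq_matI) auto
  show ?thesis
    using von_neumann_entropy_orthogonal_sum[of "{..<m} \<rightarrow>\<^sub>E {..<2}" "branch n m b \<psi>" "2 ^ n"
        "measure_first n m b (outer_prod \<psi> \<psi>)" "\<lambda>_. 1"]
    by (simp add: finite_PiE branch_carrier branch_orthogonal[OF m b _ _ _ psi]
        measure_first_outer_prod[OF b psi] one[simplified] branch_entropy_def entropy_term_def sum_negf)
qed

text \<open>Outcome tuples of \<open>m + 1\<close> qubits are tuples of \<open>m\<close> qubits with
  one more value, uniquely. This is the combinatorial half of adding a measurement.\<close>

lemma sum_PiE_lessThan_Suc: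
  "sum g ({..<Suc m} \<rightarrow>\<^sub>E {..<c}) = (\<Sum>j\<in>{..<m} \<rightarrow>\<^sub>E {..<c}. \<Sum>a<c. g (j(m := a)))"
proof -
  have "sum g ({..<Suc m} \<rightarrow>\<^sub>E {..<c})
      = sum g ((\<lambda>(y, h). h(m := y)) ` ({..<c} \<times> ({..<m} \<rightarrow>\<^sub>E {..<c})))"
    by (simp add: lessThan_Suc PiE_insert_eq)
  also have "\<dots> = (\<Sum>(y, h)\<in>{..<c} \<times> ({..<m} \<rightarrow>\<^sub>E {..<c}). g (h(m := y)))"
    using inj_combinator[of m "{..<m}" "\<lambda>_. {..<c}"] by (subst sum.reindex) (auto simp: case_prod_beta)
  also have "\<dots> = (\<Sum>j\<in>{..<m} \<rightarrow>\<^sub>E {..<c}. \<Sum>a<c. g (j(m := a)))"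
    unfolding sum.cartesian_product[symmetric] by (rule sum.swap)
  finally show ?thesis .
qed

lemma branch_Suc:
  assumes b: "\<forall>k<m. orthonormal_basis 2 (b k)" and u: "orthonormal_basis 2 u"
    and j: "j \<in> {..<m} \<rightarrow>\<^sub>E {..<2}" and a: "a < 2" and psi: "\<psi> \<in> carrier_vec (2 ^ n)"
  shows "branch n (Suc m) (b(m := u)) \<psi> (j(m := a)) = site_projector n m (u a) *\<^sub>v branch n m b \<psi> j"
  unfolding branch_def site_projector_mult_first_projector[OF b u j a, symmetric]
  by (rule assoc_mult_mat_vec[OF site_projector_carrier first_projector_carrier psi])

text \<open>A site projector maps branches to branches with one more measured qubit, so both sides
  collect the same outer products. Thus the measurement inside the discord of a measured state is
  one more step in the same sequence.\<close>

lemma measure_site_measure_first: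
  assumes b: "\<forall>k<m. orthonormal_basis 2 (b k)" and u: "orthonormal_basis 2 u"
    and psi: "\<psi> \<in> carrier_vec (2 ^ n)"
  shows "measure_site n m u (measure_first n m b (outer_prod \<psi> \<psi>))
    = measure_first n (Suc m) (b(m := u)) (outer_prod \<psi> \<psi>)" (is "?A = ?B")
proof (rule eq_matI)
  let ?J = "{..<m} \<rightarrow>\<^sub>E {..<2::nat}"
  let ?y = "\<lambda>a j. site_projector n m (u a) *\<^sub>v branch n m b \<psi> j"
  have bu: "\<forall>k<Suc m. orthonormal_basis 2 ((b(m := u)) k)" using b u by (auto simp: less_Suc_eq)
  have y: "?y a j \<in> carrier_vec (2 ^ n)" for a j
    by (rule carrier_vecI) (use site_projector_carrier[of n m "u a"] in simp)
  show "dim_row ?A = dim_row ?B" "dim_col ?A = dim_col ?B"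
    by (auto simp: measure_site_def measure_first_def mat_sum_def)
  fix s t assume "s < dim_row ?B" "t < dim_col ?B"
  then have s: "s < 2 ^ n" and t: "t < 2 ^ n" by (auto simp: measure_first_def mat_sum_def)
  have sandwich: "site_projector n m (u a) *
      mat_sum (2 ^ n) (\<lambda>j. outer_prod (branch n m b \<psi> j) (branch n m b \<psi> j)) ?J * site_projector n m (u a)
      = mat_sum (2 ^ n) (\<lambda>j. outer_prod (?y a j) (?y a j)) ?J" if "a < 2" for a
    using u that
    by (intro hermitian_sandwich_sum_outer_prod hermitian_mat_site_projector branch_carrier
        orthonormal_basis_carrier)
  have "?A $$ (s, t) = (\<Sum>a<2. mat_sum (2 ^ n) (\<lambda>j. outer_prod (?y a j) (?y a j)) ?J $$ (s, t))"
    unfolding measure_site_def mat_sum_def[of _ _ "{..<2}"] measure_first_outer_prod[OF b psi]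
    using s t sandwich by (auto intro!: sum.cong)
  also have "\<dots> = (\<Sum>a<2. \<Sum>j\<in>?J. ?y a j $ s * cnj (?y a j $ t))"
    by (intro sum.cong refl mat_sum_outer_prod_index y s t)
  also have "\<dots> = (\<Sum>j\<in>?J. \<Sum>a<2. ?y a j $ s * cnj (?y a j $ t))" by (rule sum.swap)
  also have "\<dots> = (\<Sum>j\<in>?J. \<Sum>a<2. branch n (Suc m) (b(m := u)) \<psi> (j(m := a)) $ s *
      cnj (branch n (Suc m) (b(m := u)) \<psi> (j(m := a)) $ t))"
    by (intro sum.cong refl) (simp add: branch_Suc[OF b u _ _ psi])
  also have "\<dots> = ?B $$ (s, t)"
    unfolding measure_first_outer_prod[OF bu psi]
    by (simp only: mat_sum_outer_prod_index[OF branch_carrier s t] sum_PiE_lessThan_Suc)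
  finally show "?A $$ (s, t) = ?B $$ (s, t)" .
qed

section \<open>Squared norms of projected vectors\<close>

lemma site_projector_mult_vec_index:
  assumes k: "k < n" and v: "v \<in> carrier_vec 2" and x: "x \<in> carrier_vec (2 ^ n)"
    and a: "a < 2" and r: "r < 2 ^ (n - 1)"
  shows "(site_projector n k v *\<^sub>v x) $ insert_digit k a r
    = v $ a * (\<Sum>b<2. cnj (v $ b) * x $ insert_digit k b r)"
proof -
  have less: "insert_digit k a r < 2 ^ n" using insert_digit_less[of k "n - 1"] k a r by auto
  have "(site_projector n k v *\<^sub>v x) $ insert_digit k a r
      = (\<Sum>s<2 ^ (n - 1). \<Sum>b<2. site_projector n k v $$ (insert_digit k a r, insert_digit k b s)
          * x $ insert_digit k b s)"
    unfolding mult_mat_vec_index[OF site_projector_carrier x less] by (rule sum_insert_digit[OF k])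
  also have "\<dots> = (\<Sum>s<2 ^ (n - 1). if s = r then (\<Sum>b<2. v $ a * cnj (v $ b) * x $ insert_digit k b r) else 0)"
    by (intro sum.cong refl) (auto simp: site_projector_insert_digit[OF k v a _ r] intro!: sum.neutral)
  also have "\<dots> = v $ a * (\<Sum>b<2. cnj (v $ b) * x $ insert_digit k b r)"
    using r by (simp add: sum_distrib_left mult_ac)
  finally show ?thesis .
qed

text \<open>The projected vector is \<open>v\<close> tensored with the partial inner product of
  \<open>x\<close> with \<open>v\<close>; since \<open>v\<close> has norm one, only the second
  factor counts.\<close>

lemma sq_norm_site_projector:
  assumes k: "k < n" and v: "v \<in> carrier_vec 2" "sq_norm_cvec v = 1" and x: "x \<in> carrier_vec (2 ^ n)"
  shows "sq_norm_cvec (site_projector n k v *\<^sub>v x)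
    = (\<Sum>r<2 ^ (n - 1). (cmod (\<Sum>b<2. cnj (v $ b) * x $ insert_digit k b r))\<^sup>2)"
proof -
  have "sq_norm_cvec (site_projector n k v *\<^sub>v x)
      = (\<Sum>s<2 ^ n. (cmod ((site_projector n k v *\<^sub>v x) $ s))\<^sup>2)"
    using site_projector_carrier[of n k v] by (simp add: sq_norm_cvec_def)
  also have "\<dots> = (\<Sum>r<2 ^ (n - 1). \<Sum>a<2. (cmod ((site_projector n k v *\<^sub>v x) $ insert_digit k a r))\<^sup>2)"
    by (rule sum_insert_digit[OF k])
  also have "\<dots> = (\<Sum>r<2 ^ (n - 1). (\<Sum>a<2. (cmod (v $ a))\<^sup>2) * (cmod (\<Sum>b<2. cnj (v $ b) * x $ insert_digit k b r))\<^sup>2)"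
    by (intro sum.cong refl)
      (simp add: site_projector_mult_vec_index[OF k v(1) x] norm_mult power_mult_distrib sum_distrib_right
        del: index_mult_mat_vec)
  also have "(\<Sum>a<2. (cmod (v $ a))\<^sup>2) = 1" using v by (simp add: sq_norm_cvec_def)
  finally show ?thesis by simp
qed

lemma orthonormal_basis_sq_norm: "orthonormal_basis d u \<Longrightarrow> j < d \<Longrightarrow> sq_norm_cvec (u j) = 1"
  using cscalar_prod_self[of "u j"] by (simp add: orthonormal_basis_cscalar_prod)

text \<open>After expanding the squares, summing over the basis vectors before the coordinates lets
  completeness collapse the double sum. The computation is complex, since there a squared modulus is
  a product.\<close>

lemma orthonormal_basis_parseval:
  assumes u: "orthonormal_basis d u"
  shows "(\<Sum>a<d. (cmod (\<Sum>b<d. cnj (u a $ b) * y b))\<^sup>2) = (\<Sum>b<d. (cmod (y b))\<^sup>2)"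
proof -
  have "complex_of_real (\<Sum>a<d. (cmod (\<Sum>b<d. cnj (u a $ b) * y b))\<^sup>2)
      = (\<Sum>a<d. (\<Sum>b<d. cnj (u a $ b) * y b) * (\<Sum>c<d. u a $ c * cnj (y c)))"
    by (simp del: of_real_power add: complex_norm_square)
  also have "\<dots> = (\<Sum>a<d. \<Sum>b<d. \<Sum>c<d. y b * cnj (y c) * (u a $ c * cnj (u a $ b)))"
    by (simp add: sum_product mult_ac)
  also have "\<dots> = (\<Sum>b<d. \<Sum>a<d. \<Sum>c<d. y b * cnj (y c) * (u a $ c * cnj (u a $ b)))"
    by (rule sum.swap)
  also have "\<dots> = (\<Sum>b<d. \<Sum>c<d. \<Sum>a<d. y b * cnj (y c) * (u a $ c * cnj (u a $ b)))"
    by (intro sum.cong refl sum.swap)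
  also have "\<dots> = (\<Sum>b<d. \<Sum>c<d. if c = b then y b * cnj (y b) else 0)"
    by (intro sum.cong refl) (simp add: sum_distrib_left[symmetric] orthonormal_basis_complete[OF u])
  also have "\<dots> = complex_of_real (\<Sum>b<d. (cmod (y b))\<^sup>2)"
    by (simp del: of_real_power add: complex_norm_square)
  finally show ?thesis by (simp only: of_real_eq_iff)
qed

text \<open>Parseval is applied to the two amplitudes at site \<open>k\<close>, separately for each
  configuration \<open>r\<close> of the other qubits. This is conservation of probability when a
  branch splits.\<close>

lemma sum_sq_norm_site_projector:
  assumes k: "k < n" and u: "orthonormal_basis 2 u" and x: "x \<in> carrier_vec (2 ^ n)"
  shows "(\<Sum>a<2. sq_norm_cvec (site_projector n k (u a) *\<^sub>v x)) = sq_norm_cvec x"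
proof -
  have "(\<Sum>a<2. sq_norm_cvec (site_projector n k (u a) *\<^sub>v x))
      = (\<Sum>a<2. \<Sum>r<2 ^ (n - 1). (cmod (\<Sum>b<2. cnj (u a $ b) * x $ insert_digit k b r))\<^sup>2)"
    using u by (intro sum.cong refl sq_norm_site_projector k x)
      (auto simp: orthonormal_basis_carrier orthonormal_basis_sq_norm)
  also have "\<dots> = (\<Sum>r<2 ^ (n - 1). \<Sum>a<2. (cmod (\<Sum>b<2. cnj (u a $ b) * x $ insert_digit k b r))\<^sup>2)"
    by (rule sum.swap)
  also have "\<dots> = (\<Sum>r<2 ^ (n - 1). \<Sum>b<2. (cmod (x $ insert_digit k b r))\<^sup>2)"
    by (intro sum.cong refl orthonormal_basis_parseval u)
  also have "\<dots> = (\<Sum>s<2 ^ n. (cmod (x $ s))\<^sup>2)"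
    by (rule sum_insert_digit[OF k, symmetric])
  also have "\<dots> = sq_norm_cvec x" using x by (simp add: sq_norm_cvec_def)
  finally show ?thesis .
qed

section \<open>The discord as an entropy gain\<close>

text \<open>The entry at \<open>(r, s)\<close> of the operator \<open><v| \<sigma> |v>\<close> on
  the other \<open>n - 1\<close> qubits: their unnormalized state conditional on the outcome
  \<open>v\<close>.\<close>

definition conditional_entry :: "nat \<Rightarrow> complex vec \<Rightarrow> complex mat \<Rightarrow> nat \<Rightarrow> nat \<Rightarrow> complex" where
  "conditional_entry k v \<sigma> r s =
     (\<Sum>c<2. \<Sum>d<2. cnj (v $ c) * \<sigma> $$ (insert_digit k c r, insert_digit k d s) * v $ d)"

lemma insert_digit_less_power: "k < n \<Longrightarrow> a < 2 \<Longrightarrow> r < 2 ^ (n - 1) \<Longrightarrow> insert_digit k a r < 2 ^ n"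
  using insert_digit_less[of k "n - 1" a r] by simp

lemma site_projector_mult_index:
  assumes k: "k < n" and v: "v \<in> carrier_vec 2" and S: "\<sigma> \<in> carrier_mat (2 ^ n) (2 ^ n)"
    and a: "a < 2" and r: "r < 2 ^ (n - 1)" and t: "t < 2 ^ n"
  shows "(site_projector n k v * \<sigma>) $$ (insert_digit k a r, t)
    = v $ a * (\<Sum>c<2. cnj (v $ c) * \<sigma> $$ (insert_digit k c r, t))"
proof -
  have less: "insert_digit k c r < 2 ^ n" if "c < 2" for c using insert_digit_less_power[OF k that r] .
  have col: "col \<sigma> t \<in> carrier_vec (2 ^ n)" using S by (auto simp: col_def)
  have "(site_projector n k v * \<sigma>) $$ (insert_digit k a r, t)
      = (site_projector n k v *\<^sub>v col \<sigma> t) $ insert_digit k a r"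
    using less[OF a] S t site_projector_carrier[of n k v] by simp
  also have "\<dots> = v $ a * (\<Sum>c<2. cnj (v $ c) * col \<sigma> t $ insert_digit k c r)"
    by (rule site_projector_mult_vec_index[OF k v col a r])
  also have "\<dots> = v $ a * (\<Sum>c<2. cnj (v $ c) * \<sigma> $$ (insert_digit k c r, t))"
    using S t less by (intro arg_cong2[of _ _ _ _ "(*)"] sum.cong refl) auto
  finally show ?thesis .
qed

text \<open>The sandwich factors as \<open>|v><v|\<close> on qubit \<open>k\<close> tensored with
  the conditional operator on the rest.\<close>

lemma site_projector_sandwich_index:
  assumes k: "k < n" and v: "v \<in> carrier_vec 2" and S: "\<sigma> \<in> carrier_mat (2 ^ n) (2 ^ n)"
    and a: "a < 2" and b: "b < 2" and r: "r < 2 ^ (n - 1)" and s: "s < 2 ^ (n - 1)"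
  shows "(site_projector n k v * \<sigma> * site_projector n k v) $$ (insert_digit k a r, insert_digit k b s)
    = v $ a * cnj (v $ b) * conditional_entry k v \<sigma> r s"
proof -
  let ?P = "site_projector n k v"
  have P: "?P \<in> carrier_mat (2 ^ n) (2 ^ n)" by (rule site_projector_carrier)
  have PS: "?P * \<sigma> \<in> carrier_mat (2 ^ n) (2 ^ n)" using P S by auto
  have "(?P * \<sigma> * ?P) $$ (insert_digit k a r, insert_digit k b s)
      = (\<Sum>t<2 ^ (n - 1). \<Sum>d<2. (?P * \<sigma>) $$ (insert_digit k a r, insert_digit k d t)
          * ?P $$ (insert_digit k d t, insert_digit k b s))"
    unfolding mult_mat_index[OF PS P insert_digit_less_power[OF k a r] insert_digit_less_power[OF k b s]]
    by (rule sum_insert_digit[OF k])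
  also have "\<dots> = (\<Sum>t<2 ^ (n - 1). if t = s then (\<Sum>d<2. (v $ a * (\<Sum>c<2. cnj (v $ c) *
      \<sigma> $$ (insert_digit k c r, insert_digit k d s))) * (v $ d * cnj (v $ b))) else 0)"
    by (intro sum.cong refl)
      (auto simp: site_projector_insert_digit[OF k v _ b _ s] site_projector_mult_index[OF k v S a r]
        insert_digit_less_power[OF k] simp del: index_mult_mat intro!: sum.neutral)
  also have "\<dots> = (\<Sum>d<2. (v $ a * (\<Sum>c<2. cnj (v $ c) *
      \<sigma> $$ (insert_digit k c r, insert_digit k d s))) * (v $ d * cnj (v $ b)))"
    using s by simp
  also have "\<dots> = (\<Sum>d<2. \<Sum>c<2. v $ a * cnj (v $ b) * (cnj (v $ c) *
      \<sigma> $$ (insert_digit k c r, insert_digit k d s) * v $ d))"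
    by (simp add: sum_distrib_left sum_distrib_right mult_ac)
  also have "\<dots> = v $ a * cnj (v $ b) * conditional_entry k v \<sigma> r s"
    unfolding conditional_entry_def sum_distrib_left by (rule sum.swap)
  finally show ?thesis .
qed

lemma measure_site_index:
  assumes k: "k < n" and u: "orthonormal_basis 2 u" and S: "\<sigma> \<in> carrier_mat (2 ^ n) (2 ^ n)"
    and a: "a < 2" and b: "b < 2" and r: "r < 2 ^ (n - 1)" and s: "s < 2 ^ (n - 1)"
  shows "measure_site n k u \<sigma> $$ (insert_digit k a r, insert_digit k b s)
    = (\<Sum>j<2. u j $ a * cnj (u j $ b) * conditional_entry k (u j) \<sigma> r s)"
proof -
  have "measure_site n k u \<sigma> $$ (insert_digit k a r, insert_digit k b s)
      = (\<Sum>j<2. (site_projector n k (u j) * \<sigma> * site_projector n k (u j))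
          $$ (insert_digit k a r, insert_digit k b s))"
    using insert_digit_less_power[OF k a r] insert_digit_less_power[OF k b s]
    by (simp add: measure_site_def mat_sum_def)
  also have "\<dots> = (\<Sum>j<2. u j $ a * cnj (u j $ b) * conditional_entry k (u j) \<sigma> r s)"
    using u by (intro sum.cong refl site_projector_sandwich_index[OF k _ S a b r s])
      (auto simp: orthonormal_basis_carrier)
  finally show ?thesis .
qed

text \<open>Tracing out the measured qubit leaves the sum of the conditional operators, which
  completeness of the basis turns back into the partial trace. This is the no-signalling property of
  local measurements.\<close>

lemma reduced_rest_measure_site:
  assumes k: "k < n" and u: "orthonormal_basis 2 u" and S: "\<sigma> \<in> carrier_mat (2 ^ n) (2 ^ n)"
  shows "reduced_rest n k (measure_site n k u \<sigma>) = reduced_rest n k \<sigma>"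
proof (rule eq_matI)
  fix r s assume "r < dim_row (reduced_rest n k \<sigma>)" "s < dim_col (reduced_rest n k \<sigma>)"
  then have r: "r < 2 ^ (n - 1)" and s: "s < 2 ^ (n - 1)" by (auto simp: reduced_rest_def)
  have norm1: "(\<Sum>a<2. u j $ a * cnj (u j $ a)) = 1" if "j < 2" for j
    using orthonormal_basis_cscalar_prod[OF u that that] cscalar_prod_sum[OF orthonormal_basis_carrier[OF u that]]
    by simp
  have "reduced_rest n k (measure_site n k u \<sigma>) $$ (r, s)
      = (\<Sum>a<2. \<Sum>j<2. u j $ a * cnj (u j $ a) * conditional_entry k (u j) \<sigma> r s)"
    using r s by (simp add: reduced_rest_def) (intro sum.cong refl measure_site_index[OF k u S], auto)
  also have "\<dots> = (\<Sum>j<2. (\<Sum>a<2. u j $ a * cnj (u j $ a)) * conditional_entry k (u j) \<sigma> r s)"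
    unfolding sum_distrib_right by (rule sum.swap)
  also have "\<dots> = (\<Sum>j<2. conditional_entry k (u j) \<sigma> r s)"
    by (intro sum.cong refl) (simp only: norm1 lessThan_iff mult_1)
  also have "\<dots> = (\<Sum>c<2. \<Sum>j<2. \<Sum>d<2. cnj (u j $ c) * \<sigma> $$ (insert_digit k c r, insert_digit k d s) * u j $ d)"
    unfolding conditional_entry_def by (rule sum.swap)
  also have "\<dots> = (\<Sum>c<2. \<Sum>d<2. \<Sum>j<2. cnj (u j $ c) * \<sigma> $$ (insert_digit k c r, insert_digit k d s) * u j $ d)"
    by (intro sum.cong refl sum.swap)
  also have "\<dots> = (\<Sum>c<2. \<Sum>d<2. \<sigma> $$ (insert_digit k c r, insert_digit k d s) * (\<Sum>j<2. u j $ d * cnj (u j $ c)))"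
    unfolding sum_distrib_left by (intro sum.cong refl) (simp only: mult_ac)
  also have "\<dots> = (\<Sum>c<2. \<Sum>d<2. if d = c then \<sigma> $$ (insert_digit k c r, insert_digit k c s) else 0)"
    by (intro sum.cong refl) (simp add: orthonormal_basis_complete[OF u])
  also have "\<dots> = reduced_rest n k \<sigma> $$ (r, s)"
    using r s by (simp add: reduced_rest_def)
  finally show "reduced_rest n k (measure_site n k u \<sigma>) $$ (r, s) = reduced_rest n k \<sigma> $$ (r, s)" .
qed (auto simp: reduced_rest_def)

lemma conditional_entry_real:
  assumes k: "k < n" and S: "hermitian_mat (2 ^ n) \<sigma>" and r: "r < 2 ^ (n - 1)"
  shows "cnj (conditional_entry k v \<sigma> r r) = conditional_entry k v \<sigma> r r"
proof -
  have "cnj (conditional_entry k v \<sigma> r r)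
      = (\<Sum>c<2. \<Sum>d<2. cnj (v $ d) * \<sigma> $$ (insert_digit k d r, insert_digit k c r) * v $ c)"
    unfolding conditional_entry_def cnj_sum
    using S insert_digit_less_power[OF k _ r]
    by (intro sum.cong refl) (simp add: hermitian_mat_def mult_ac)
  also have "\<dots> = conditional_entry k v \<sigma> r r"
    unfolding conditional_entry_def by (rule sum.swap)
  finally show ?thesis .
qed

text \<open>\<open>outcome_prob\<close> keeps only a real part; for hermitian
  \<open>\<sigma>\<close> the trace is already real, so nothing is lost.\<close>

lemma outcome_prob_eq:
  assumes k: "k < n" and u: "orthonormal_basis 2 u" and S: "hermitian_mat (2 ^ n) \<sigma>" and j: "j < 2"
  shows "complex_of_real (outcome_prob n k u \<sigma> j) = (\<Sum>r<2 ^ (n - 1). conditional_entry k (u j) \<sigma> r r)"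
proof -
  let ?P = "site_projector n k (u j)"
  have Sc: "\<sigma> \<in> carrier_mat (2 ^ n) (2 ^ n)" using S by (simp add: hermitian_mat_def)
  have uj: "u j \<in> carrier_vec 2" by (rule orthonormal_basis_carrier[OF u j])
  have dim: "dim_row (?P * \<sigma>) = 2 ^ n" using site_projector_carrier[of n k "u j"] by simp
  have "mat_trace (?P * \<sigma>) = (\<Sum>r<2 ^ (n - 1). \<Sum>a<2. (?P * \<sigma>) $$ (insert_digit k a r, insert_digit k a r))"
    unfolding mat_trace_def dim by (rule sum_insert_digit[OF k])
  also have "\<dots> = (\<Sum>r<2 ^ (n - 1). \<Sum>a<2. u j $ a * (\<Sum>c<2. cnj (u j $ c) * \<sigma> $$ (insert_digit k c r, insert_digit k a r)))"
    by (intro sum.cong refl) (simp add: site_projector_mult_index[OF k uj Sc] insert_digit_less_power[OF k] del: index_mult_mat)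
  also have "\<dots> = (\<Sum>r<2 ^ (n - 1). \<Sum>a<2. \<Sum>c<2. cnj (u j $ c) * \<sigma> $$ (insert_digit k c r, insert_digit k a r) * u j $ a)"
    unfolding sum_distrib_left by (intro sum.cong refl) (simp only: mult_ac)
  also have "\<dots> = (\<Sum>r<2 ^ (n - 1). conditional_entry k (u j) \<sigma> r r)"
    unfolding conditional_entry_def by (intro sum.cong refl sum.swap)
  finally have tr: "mat_trace (?P * \<sigma>) = (\<Sum>r<2 ^ (n - 1). conditional_entry k (u j) \<sigma> r r)" .
  have "cnj (\<Sum>r<2 ^ (n - 1). conditional_entry k (u j) \<sigma> r r) = (\<Sum>r<2 ^ (n - 1). conditional_entry k (u j) \<sigma> r r)"
    unfolding cnj_sum by (intro sum.cong refl conditional_entry_real[OF k S]) simp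
  then have "complex_of_real (Re (mat_trace (?P * \<sigma>))) = mat_trace (?P * \<sigma>)"
    unfolding tr by (metis Reals_cnj_iff of_real_Re)
  then show ?thesis using tr by (simp only: outcome_prob_def)
qed

text \<open>Tracing out the other qubits replaces each conditional operator by its trace, the
  outcome probability, and leaves a matrix diagonal in the measured basis.\<close>

lemma reduced_site_measure_site:
  assumes k: "k < n" and u: "orthonormal_basis 2 u" and S: "hermitian_mat (2 ^ n) \<sigma>"
  shows "reduced_site n k (measure_site n k u \<sigma>)
    = mat_sum 2 (\<lambda>j. complex_of_real (outcome_prob n k u \<sigma> j) \<cdot>\<^sub>m outer_prod (u j) (u j)) {..<2}"
    (is "?A = ?B")
proof (rule eq_matI)
  have Sc: "\<sigma> \<in> carrier_mat (2 ^ n) (2 ^ n)" using S by (simp add: hermitian_mat_def)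
  fix a b assume "a < dim_row ?B" "b < dim_col ?B"
  then have a: "a < 2" and b: "b < 2" by (auto simp: mat_sum_def)
  have dim: "dim_vec (u j) = 2" if "j < 2" for j using orthonormal_basis_carrier[OF u that] by simp
  have "?A $$ (a, b) = (\<Sum>r<2 ^ (n - 1). \<Sum>j<2. u j $ a * cnj (u j $ b) * conditional_entry k (u j) \<sigma> r r)"
    using a b by (simp add: reduced_site_def) (intro sum.cong refl measure_site_index[OF k u Sc], auto)
  also have "\<dots> = (\<Sum>j<2. u j $ a * cnj (u j $ b) * (\<Sum>r<2 ^ (n - 1). conditional_entry k (u j) \<sigma> r r))"
    unfolding sum_distrib_left by (rule sum.swap)
  also have "\<dots> = (\<Sum>j<2. u j $ a * cnj (u j $ b) * complex_of_real (outcome_prob n k u \<sigma> j))"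
    by (intro sum.cong refl) (simp only: outcome_prob_eq[OF k u S] lessThan_iff)
  also have "\<dots> = ?B $$ (a, b)"
    using a b dim by (auto simp: mat_sum_def outer_prod_def intro!: sum.cong)
  finally show "?A $$ (a, b) = ?B $$ (a, b)" .
qed (auto simp: reduced_site_def mat_sum_def)

lemma entropy_reduced_site_measure_site:
  assumes k: "k < n" and u: "orthonormal_basis 2 u" and S: "hermitian_mat (2 ^ n) \<sigma>"
  shows "von_neumann_entropy (reduced_site n k (measure_site n k u \<sigma>))
    = shannon_entropy 2 (outcome_prob n k u \<sigma>)"
proof -
  have "von_neumann_entropy (reduced_site n k (measure_site n k u \<sigma>)) =
    - (\<Sum>j<2. outcome_prob n k u \<sigma> j * sq_norm_cvec (u j) * log 2 (outcome_prob n k u \<sigma> j * sq_norm_cvec (u j)))"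
    using u by (intro von_neumann_entropy_orthogonal_sum[of "{..<2}" u 2] reduced_site_measure_site[OF k u S])
      (auto simp: orthonormal_basis_def)
  then show ?thesis by (simp add: shannon_entropy_def orthonormal_basis_sq_norm[OF u])
qed

text \<open>The entropy of the rest is unchanged and cancels. That of the unmeasured qubit cancels
  between the two brackets, and that of the measured qubit cancels against the Shannon
  entropy.\<close>

lemma discord_functional_eq_entropy_gain:
  assumes k: "k < n" and u: "orthonormal_basis 2 u" and S: "hermitian_mat (2 ^ n) \<sigma>"
  shows "(mutual_information n k \<sigma> - mutual_information n k (measure_site n k u \<sigma>))
      + (shannon_entropy 2 (outcome_prob n k u \<sigma>) - von_neumann_entropy (reduced_site n k \<sigma>))
    = von_neumann_entropy (measure_site n k u \<sigma>) - von_neumann_entropy \<sigma>"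
proof -
  have "\<sigma> \<in> carrier_mat (2 ^ n) (2 ^ n)" using S by (simp add: hermitian_mat_def)
  then show ?thesis
    by (simp add: mutual_information_def reduced_rest_measure_site[OF k u] entropy_reduced_site_measure_site[OF k u S])
qed

section \<open>Monotonicity and attained minima of the entropy\<close>

text \<open>Monotonicity of the logarithm gives \<open>log x <= log (x + y)\<close>, weighted by
  \<open>x\<close> and by \<open>y\<close>. Zero arguments are separate, because the value
  \<open>log 2 0 = 0\<close> breaks monotonicity.\<close>

lemma entropy_term_add_le:
  assumes "x \<ge> 0" "y \<ge> 0"
  shows "entropy_term (x + y) \<le> entropy_term x + entropy_term y"
proof (cases "x = 0 \<or> y = 0")
  case False
  then have "x * log 2 x \<le> x * log 2 (x + y)" "y * log 2 y \<le> y * log 2 (x + y)"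
    using assms by (auto intro!: mult_left_mono)
  then show ?thesis by (simp add: entropy_term_def distrib_right)
qed (auto simp: entropy_term_def)

text \<open>The right side is the tangent of \<open>- x log x\<close> at \<open>z\<close>, and the
  bound is \<open>ln t <= t - 1\<close> at \<open>t = z / x\<close>.\<close>

lemma entropy_term_le_tangent:
  assumes "x \<ge> 0" "z > 0"
  shows "entropy_term x \<le> - (x * log 2 z) + (z - x) / ln 2"
proof (cases "x = 0")
  case True
  then show ?thesis using assms by (simp add: entropy_term_def)
next
  case False
  then have x: "x > 0" using assms by simp
  have "ln (z / x) \<le> z / x - 1" using x assms by (intro ln_le_minus_one) simp
  then have "x * (ln z - ln x) \<le> x * (z / x - 1)"
    using x assms by (intro mult_left_mono) (auto simp: ln_div)
  then have "x * (ln z - ln x) \<le> z - x" using x by (simp add: right_diff_distrib)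
  then have "x * (ln z - ln x) / ln 2 \<le> (z - x) / ln 2" by (intro divide_right_mono) auto
  then show ?thesis by (simp add: entropy_term_def log_def field_simps)
qed

text \<open>Both values are compared with the tangent at the weighted mean, where the linear terms
  cancel. A mean of zero has no tangent; there each summand has zero weight or zero
  argument.\<close>

lemma entropy_term_concave:
  assumes "x \<ge> 0" "y \<ge> 0" "a \<ge> 0" "c \<ge> 0" "a + c = 1"
  shows "a * entropy_term x + c * entropy_term y \<le> entropy_term (a * x + c * y)"
proof (cases "a * x + c * y = 0")
  case True
  then have "a * x = 0" "c * y = 0" using assms by (simp_all add: add_nonneg_eq_0_iff)
  then show ?thesis by (auto simp: entropy_term_def)
next
  case False
  define z where "z = a * x + c * y"
  have z: "z > 0" using False assms unfolding z_def by (metis add_nonneg_nonneg less_eq_real_def mult_nonneg_nonneg)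
  have "a * entropy_term x + c * entropy_term y
      \<le> a * (- (x * log 2 z) + (z - x) / ln 2) + c * (- (y * log 2 z) + (z - y) / ln 2)"
    using assms z by (intro add_mono mult_left_mono entropy_term_le_tangent)
  also have "\<dots> = - ((a * x + c * y) * log 2 z) + ((a + c) * z - (a * x + c * y)) / ln 2"
    by (simp add: field_simps)
  also have "\<dots> = - (z * log 2 z) + ((a + c) * z - z) / ln 2" by (simp only: z_def)
  also have "\<dots> = entropy_term z" using assms(5) by (simp add: entropy_term_def)
  finally show ?thesis by (simp add: z_def)
qed

lemma continuous_on_entropy_term: "continuous_on {0..} entropy_term"
proof -
  have "(entropy_term \<longlongrightarrow> entropy_term x) (at x within {0..})" if x: "x \<ge> 0" for x
  proof (cases "x = 0")
    case True
    \<comment> \<open>\<open>- x ln x\<close> is \<open>ln t / t\<close> at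
      \<open>t = 1 / x\<close>, so continuity at zero is a limit at infinity.\<close>
    have "((\<lambda>x::real. ln (inverse x) / inverse x) \<longlongrightarrow> 0) (at_right 0)"
      by (rule filterlim_compose[OF ln_x_over_x_tendsto_0 filterlim_inverse_at_top_right])
    then have "((\<lambda>x::real. ln (inverse x) / inverse x / ln 2) \<longlongrightarrow> 0 / ln 2) (at_right 0)"
      by (intro tendsto_divide tendsto_const) auto
    moreover have "eventually (\<lambda>x. ln (inverse x) / inverse x / ln 2 = entropy_term x) (at_right 0)"
      using eventually_at_right_less[of "0::real"]
      by eventually_elim (simp add: entropy_term_def log_def ln_div field_simps)
    ultimately have "(entropy_term \<longlongrightarrow> 0 / ln 2) (at_right 0)" by (rule Lim_transform_eventually)
    then show ?thesis using True by (simp add: at_within_Ici_at_right entropy_term_def)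
  next
    case False
    then have "isCont entropy_term x"
      unfolding entropy_term_def[abs_def] using x by (intro continuous_intros) auto
    then show ?thesis by (simp add: continuous_at tendsto_within_subset[of _ _ _ UNIV])
  qed
  then show ?thesis by (simp add: continuous_on_def)
qed

lemma sum_lessThan_2: "(\<Sum>a<2. f a) = f 0 + f (1::nat)" for f :: "nat \<Rightarrow> 'a :: comm_monoid_add"
  by (simp add: numeral_2_eq_2)

lemma branch_entropy_Suc:
  assumes b: "\<forall>k<m. orthonormal_basis 2 (b k)" and u: "orthonormal_basis 2 u"
    and psi: "\<psi> \<in> carrier_vec (2 ^ n)"
  shows "branch_entropy n (Suc m) (b(m := u)) \<psi> = (\<Sum>j\<in>{..<m} \<rightarrow>\<^sub>E {..<2}.
    \<Sum>a<2. entropy_term (sq_norm_cvec (site_projector n m (u a) *\<^sub>v branch n m b \<psi> j)))"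
  unfolding branch_entropy_def sum_PiE_lessThan_Suc
  by (intro sum.cong refl) (simp add: branch_Suc[OF b u _ _ psi])

text \<open>Each branch splits into two whose squared norms add up to its own, and
  \<open>entropy_term\<close> is subadditive.\<close>

lemma branch_entropy_le_Suc:
  assumes m: "m < n" and b: "\<forall>k<m. orthonormal_basis 2 (b k)" and u: "orthonormal_basis 2 u"
    and psi: "\<psi> \<in> carrier_vec (2 ^ n)"
  shows "branch_entropy n m b \<psi> \<le> branch_entropy n (Suc m) (b(m := u)) \<psi>"
  unfolding branch_entropy_Suc[OF b u psi] branch_entropy_def[of n m]
proof (rule sum_mono)
  fix j
  let ?q = "\<lambda>a. sq_norm_cvec (site_projector n m (u a) *\<^sub>v branch n m b \<psi> j)"
  have "entropy_term (sq_norm_cvec (branch n m b \<psi> j)) = entropy_term (?q 0 + ?q 1)"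
    using sum_sq_norm_site_projector[OF m u branch_carrier, of m b \<psi> j] by (simp add: sum_lessThan_2)
  also have "\<dots> \<le> entropy_term (?q 0) + entropy_term (?q 1)"
    by (intro entropy_term_add_le sq_norm_cvec_nonneg)
  finally show "entropy_term (sq_norm_cvec (branch n m b \<psi> j)) \<le> (\<Sum>a<2. entropy_term (?q a))"
    by (simp add: sum_lessThan_2)
qed

text \<open>Completes a unit vector \<open>(x, y)\<close> by the orthogonal vector
  \<open>(- cnj y, cnj x)\<close>, so that each point of the unit sphere yields a
  measurement.\<close>

definition qubit_basis :: "complex \<Rightarrow> complex \<Rightarrow> nat \<Rightarrow> complex vec" where
  "qubit_basis x y j = vec 2 (\<lambda>i. if j = 0 then (if i = 0 then x else y) else (if i = 0 then - cnj y else cnj x))"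

lemma orthonormal_basis_qubit_basis:
  assumes "(cmod x)\<^sup>2 + (cmod y)\<^sup>2 = 1"
  shows "orthonormal_basis 2 (qubit_basis x y)"
proof -
  have "x * cnj x + y * cnj y = complex_of_real ((cmod x)\<^sup>2 + (cmod y)\<^sup>2)"
    by (simp only: of_real_add complex_norm_square)
  then have "x * cnj x + y * cnj y = 1" using assms by simp
  moreover have "qubit_basis x y j \<in> carrier_vec 2" for j by (simp add: qubit_basis_def)
  ultimately show ?thesis unfolding orthonormal_basis_def
    by (auto simp: cscalar_prod_sum[of _ 2] sum_lessThan_2 less_2_cases_iff)
       (auto simp: qubit_basis_def algebra_simps)
qed

text \<open>On the sphere of unit vectors of a qubit the entropy of the measured state is continuous,
  so that the minimum in the definition of the discord is attained.\<close>

lemma branch_entropy_attains_min: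
  assumes m: "m < n" and b: "\<forall>k<m. orthonormal_basis 2 (b k)" and psi: "\<psi> \<in> carrier_vec (2 ^ n)"
  obtains u where "orthonormal_basis 2 u"
    "\<And>u'. orthonormal_basis 2 u' \<Longrightarrow>
      branch_entropy n (Suc m) (b(m := u)) \<psi> \<le> branch_entropy n (Suc m) (b(m := u')) \<psi>"
proof -
  let ?J = "{..<m} \<rightarrow>\<^sub>E {..<2::nat}"
  let ?x = "branch n m b \<psi>"
  define g where "g j z = (\<Sum>r<2 ^ (n - 1).
    (cmod (cnj (fst z) * ?x j $ insert_digit m 0 r + cnj (snd z) * ?x j $ insert_digit m 1 r))\<^sup>2)"
    for j and z :: "complex \<times> complex"
  \<comment> \<open>The second outcome carries the rest of the squared norm, so the entropy depends
    on the basis only through its first vector. Minimizing over bases becomes minimizing over a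
    sphere.\<close>
  define f where "f z = (\<Sum>j\<in>?J. entropy_term (g j z) + entropy_term (sq_norm_cvec (?x j) - g j z))" for z
  have q0: "sq_norm_cvec (site_projector n m (u 0) *\<^sub>v ?x j) = g j (u 0 $ 0, u 0 $ 1)"
    if "orthonormal_basis 2 u" for u j
    using sq_norm_site_projector[OF m _ _ branch_carrier, of "u 0" m b \<psi> j] that
    by (simp add: orthonormal_basis_carrier orthonormal_basis_sq_norm sum_lessThan_2 g_def)
  have q1: "sq_norm_cvec (site_projector n m (u 1) *\<^sub>v ?x j)
      = sq_norm_cvec (?x j) - g j (u 0 $ 0, u 0 $ 1)" if "orthonormal_basis 2 u" for u j
    using sum_sq_norm_site_projector[OF m that branch_carrier, of m b \<psi> j] q0[OF that, of j]
    by (simp add: sum_lessThan_2)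
  have H: "branch_entropy n (Suc m) (b(m := u)) \<psi> = f (u 0 $ 0, u 0 $ 1)" if "orthonormal_basis 2 u" for u
    unfolding branch_entropy_Suc[OF b that psi] f_def using q0[OF that] q1[OF that]
    by (simp add: sum_lessThan_2)
  let ?S = "sphere (0 :: complex \<times> complex) 1"
  have sphere: "orthonormal_basis 2 (qubit_basis (fst z) (snd z))" if "z \<in> ?S" for z
    using that by (intro orthonormal_basis_qubit_basis) (simp add: norm_prod_def)
  have qz: "(qubit_basis (fst z) (snd z) 0 $ 0, qubit_basis (fst z) (snd z) 0 $ 1) = z" for z
    by (simp add: qubit_basis_def)
  have gcont: "continuous_on ?S (g j)" for j
    unfolding g_def[abs_def] by (intro continuous_intros)
  have "g j z \<ge> 0" for j z by (simp add: g_def sum_nonneg)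
  \<comment> \<open>Both arguments must stay in \<open>{0..}\<close>, where
    \<open>entropy_term\<close> is continuous; this difference is itself a squared norm.\<close>
  moreover have "sq_norm_cvec (?x j) - g j z \<ge> 0" if "z \<in> ?S" for j z
    using q1[OF sphere[OF that], of j] qz[of z]
      sq_norm_cvec_nonneg[of "site_projector n m (qubit_basis (fst z) (snd z) 1) *\<^sub>v ?x j"] by simp
  ultimately have "continuous_on ?S f"
    unfolding f_def[abs_def]
    by (intro continuous_intros continuous_on_compose2[OF continuous_on_entropy_term] gcont) auto
  moreover have "compact ?S" by simp
  moreover have "(1, 0) \<in> ?S" by (simp add: norm_prod_def)
  ultimately obtain z where z: "z \<in> ?S" "\<And>y. y \<in> ?S \<Longrightarrow> f z \<le> f y"
    using continuous_attains_inf[of ?S f] by blast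
  show ?thesis
  proof (rule that[OF sphere[OF z(1)]])
    fix u' assume u': "orthonormal_basis 2 u'"
    have "sq_norm_cvec (u' 0) = 1" "u' 0 \<in> carrier_vec 2"
      using u' by (auto simp: orthonormal_basis_sq_norm orthonormal_basis_carrier)
    then have "(u' 0 $ 0, u' 0 $ 1) \<in> ?S"
      by (simp add: norm_prod_def sq_norm_cvec_def sum_lessThan_2)
    then show "branch_entropy n (Suc m) (b(m := qubit_basis (fst z) (snd z))) \<psi>
        \<le> branch_entropy n (Suc m) (b(m := u')) \<psi>"
      using H[OF u'] H[OF sphere[OF z(1)]] qz[of z] z(2) by simp
  qed
qed

section \<open>Schmidt states\<close>

lemma sq_norm_add_orthogonal:
  assumes x: "x \<in> carrier_vec N" and y: "y \<in> carrier_vec N" and orth: "x \<bullet>c y = 0"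
  shows "sq_norm_cvec (\<alpha> \<cdot>\<^sub>v x + \<beta> \<cdot>\<^sub>v y) = (cmod \<alpha>)\<^sup>2 * sq_norm_cvec x + (cmod \<beta>)\<^sup>2 * sq_norm_cvec y"
proof -
  let ?z = "\<alpha> \<cdot>\<^sub>v x + \<beta> \<cdot>\<^sub>v y"
  have z: "?z \<in> carrier_vec N" using x y by simp
  have "complex_of_real (sq_norm_cvec ?z) = ?z \<bullet>c ?z" by (rule cscalar_prod_self[symmetric])
  also have "\<dots> = (\<Sum>i<N. \<alpha> * cnj \<alpha> * (x $ i * cnj (x $ i)) + \<beta> * cnj \<beta> * (y $ i * cnj (y $ i))
      + \<alpha> * cnj \<beta> * (x $ i * cnj (y $ i)) + \<beta> * cnj \<alpha> * (y $ i * cnj (x $ i)))"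
    unfolding cscalar_prod_sum[OF z] using x y by (intro sum.cong) (auto simp: algebra_simps)
  also have "\<dots> = \<alpha> * cnj \<alpha> * (x \<bullet>c x) + \<beta> * cnj \<beta> * (y \<bullet>c y) + \<alpha> * cnj \<beta> * (x \<bullet>c y) + \<beta> * cnj \<alpha> * (y \<bullet>c x)"
    by (simp only: sum.distrib sum_distrib_left cscalar_prod_sum[OF x] cscalar_prod_sum[OF y])
  also have "\<dots> = complex_of_real ((cmod \<alpha>)\<^sup>2 * sq_norm_cvec x + (cmod \<beta>)\<^sup>2 * sq_norm_cvec y)"
    using orth cscalar_prod_commute[OF x y] by (simp only: complex_norm_square[symmetric] cscalar_prod_self) simp
  finally show ?thesis by (simp only: of_real_eq_iff)
qed

lemma sq_norm_tensor_vec: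
  assumes "\<And>k. k < n \<Longrightarrow> v k \<in> carrier_vec 2"
  shows "sq_norm_cvec (tensor_vec n v) = (\<Prod>k<n. sq_norm_cvec (v k))"
proof -
  have "complex_of_real (sq_norm_cvec (tensor_vec n v)) = complex_of_real (\<Prod>k<n. sq_norm_cvec (v k))"
    using tensor_vec_cscalar_prod[of n v v] assms by (simp add: cscalar_prod_self)
  then show ?thesis by (simp only: of_real_eq_iff)
qed

text \<open>Parseval for the coordinates of \<open>v\<close>. Used in both directions, it makes the
  squared overlaps of two bases doubly stochastic.\<close>

lemma orthonormal_basis_transition_sum:
  assumes u: "orthonormal_basis d u" and v: "v \<in> carrier_vec d" "sq_norm_cvec v = 1"
  shows "(\<Sum>a<d. (cmod (v \<bullet>c u a))\<^sup>2) = 1"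
proof -
  have "(\<Sum>a<d. (cmod (v \<bullet>c u a))\<^sup>2) = (\<Sum>a<d. (cmod (\<Sum>b<d. cnj (u a $ b) * v $ b))\<^sup>2)"
    by (intro sum.cong refl) (simp add: cscalar_prod_sum[OF orthonormal_basis_carrier[OF u]] mult.commute)
  also have "\<dots> = sq_norm_cvec v"
    using v by (simp add: orthonormal_basis_parseval[OF u] sq_norm_cvec_def)
  finally show ?thesis using v by simp
qed

lemma cmod_cscalar_prod_commute:
  "v \<in> carrier_vec N \<Longrightarrow> w \<in> carrier_vec N \<Longrightarrow> cmod (w \<bullet>c v) = cmod (v \<bullet>c w)"
  by (metis cscalar_prod_commute complex_mod_cnj)

section \<open>The discord of a partially measured pure state\<close>

lemma branch_zero: "\<psi> \<in> carrier_vec (2 ^ n) \<Longrightarrow> branch n 0 b \<psi> j = \<psi>"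
proof -
  assume psi: "\<psi> \<in> carrier_vec (2 ^ n)"
  have "first_projector n 0 b j = 1\<^sub>m (2 ^ n)"
  proof (rule eq_matI)
    fix s t assume "s < dim_row (1\<^sub>m (2 ^ n))" "t < dim_col (1\<^sub>m (2 ^ n))"
    then have st: "s < 2 ^ n" "t < 2 ^ n" by auto
    show "first_projector n 0 b j $$ (s, t) = 1\<^sub>m (2 ^ n) $$ (s, t)"
    proof (cases "s = t")
      case False
      then obtain l where "l < n" "qubit_digit s l \<noteq> qubit_digit t l"
        using qubit_digits_eqI st by blast
      then show ?thesis using False st
        by (auto simp: first_projector_def tensor_mat_def qubit_digit_less intro!: prod_zero bexI[of _ l])
    qed (use st in \<open>simp add: first_projector_def tensor_mat_def qubit_digit_less\<close>)
  qed (auto simp: first_projector_def tensor_mat_def)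
  then show ?thesis using psi by (simp add: branch_def)
qed

lemma measure_first_zero:
  assumes psi: "\<psi> \<in> carrier_vec (2 ^ n)"
  shows "measure_first n 0 b (outer_prod \<psi> \<psi>) = outer_prod \<psi> \<psi>"
proof -
  \<comment> \<open>There is exactly one empty outcome tuple: the function that is
    \<open>undefined\<close> everywhere. With no measurement as the case \<open>m = 0\<close>, the
    entropy of the pure state and its first discord need no separate treatment.\<close>
  have "measure_first n 0 b (outer_prod \<psi> \<psi>) = mat_sum (2 ^ n) (\<lambda>j. outer_prod \<psi> \<psi>) {\<lambda>_::nat. undefined :: nat}"
    using measure_first_outer_prod[of 0 b \<psi> n] psi by (simp add: branch_zero)
  also have "\<dots> = outer_prod \<psi> \<psi>"
    using psi by (intro eq_matI) (auto simp: mat_sum_def outer_prod_def)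
  finally show ?thesis .
qed

lemma thermal_discord_measure_first:
  assumes i: "i < n" and b: "\<forall>k<i. orthonormal_basis 2 (b k)" and psi: "\<psi> \<in> carrier_vec (2 ^ n)"
  shows "thermal_discord n (measure_first n i b (outer_prod \<psi> \<psi>)) i
    = (LEAST x. \<exists>u. orthonormal_basis 2 u \<and>
        x = branch_entropy n (Suc i) (b(i := u)) \<psi> - branch_entropy n i b \<psi>)"
proof -
  let ?\<sigma> = "measure_first n i b (outer_prod \<psi> \<psi>)"
  have herm: "hermitian_mat (2 ^ n) ?\<sigma>"
    unfolding measure_first_outer_prod[OF b psi] by (rule hermitian_mat_sum_outer_prod) (rule branch_carrier)
  have "(mutual_information n i ?\<sigma> - mutual_information n i (measure_site n i u ?\<sigma>))
      + (shannon_entropy 2 (outcome_prob n i u ?\<sigma>) - von_neumann_entropy (reduced_site n i ?\<sigma>))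
    = branch_entropy n (Suc i) (b(i := u)) \<psi> - branch_entropy n i b \<psi>" if u: "orthonormal_basis 2 u" for u
  proof -
    have bu: "\<forall>k<Suc i. orthonormal_basis 2 ((b(i := u)) k)" using b u by (auto simp: less_Suc_eq)
    show ?thesis
      unfolding discord_functional_eq_entropy_gain[OF i u herm]
      unfolding measure_site_measure_first[OF b u psi]
        von_neumann_entropy_measure_first[OF less_imp_le[OF i] b psi]
        von_neumann_entropy_measure_first[OF Suc_leI[OF i] bu psi] ..
  qed
  then show ?thesis unfolding thermal_discord_def by (intro arg_cong[of _ _ Least] ext) (metis (no_types, lifting))
qed

text \<open>Every candidate value is an entropy gain and hence nonnegative, but \<open>LEAST\<close>
  inherits this only if a least candidate exists. The minimizing basis supplies it.\<close>

lemma thermal_discord_measure_first_nonneg: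
  assumes i: "i < n" and b: "\<forall>k<i. orthonormal_basis 2 (b k)" and psi: "\<psi> \<in> carrier_vec (2 ^ n)"
  shows "thermal_discord n (measure_first n i b (outer_prod \<psi> \<psi>)) i \<ge> 0"
proof -
  obtain u where u: "orthonormal_basis 2 u"
    "\<And>u'. orthonormal_basis 2 u' \<Longrightarrow>
      branch_entropy n (Suc i) (b(i := u)) \<psi> \<le> branch_entropy n (Suc i) (b(i := u')) \<psi>"
    using branch_entropy_attains_min[OF i b psi] by blast
  have "thermal_discord n (measure_first n i b (outer_prod \<psi> \<psi>)) i
      = branch_entropy n (Suc i) (b(i := u)) \<psi> - branch_entropy n i b \<psi>"
    unfolding thermal_discord_measure_first[OF assms] using u by (intro Least_equality) auto
  then show ?thesis using branch_entropy_le_Suc[OF i b u(1) psi] by simp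
qed

section \<open>Outcome probabilities and entropies of Schmidt states\<close>

definition schmidt_vec :: "nat \<Rightarrow> (nat \<Rightarrow> real) \<Rightarrow> (nat \<Rightarrow> nat \<Rightarrow> complex vec) \<Rightarrow> complex vec" where
  "schmidt_vec n p e = complex_of_real (sqrt (p 0)) \<cdot>\<^sub>v tensor_vec n (\<lambda>k. e k 0)
           + complex_of_real (sqrt (p 1)) \<cdot>\<^sub>v tensor_vec n (\<lambda>k. e k 1)"

lemma schmidt_vec_carrier: "schmidt_vec n p e \<in> carrier_vec (2 ^ n)"
  by (simp add: schmidt_vec_def)

text \<open>The two projected Schmidt terms are orthogonal product vectors, so the probability is a
  classical mixture of the two. Orthogonality comes from an unmeasured qubit, or from an outcome
  vector orthogonal to one of the Schmidt vectors; the assumption \<open>orth\<close> demands one of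
  these because the terms can interfere otherwise.\<close>

lemma sq_norm_branch_schmidt_vec:
  assumes m: "m \<le> n" and e: "\<forall>k<n. orthonormal_basis 2 (e k)" and b: "\<forall>k<m. orthonormal_basis 2 (b k)"
    and j: "\<And>k. k < m \<Longrightarrow> j k < 2" and p: "p 0 \<ge> 0" "p 1 \<ge> 0"
    and orth: "m < n \<or> (\<exists>k<m. e k 0 \<bullet>c b k (j k) = 0 \<or> e k 1 \<bullet>c b k (j k) = 0)"
  shows "sq_norm_cvec (branch n m b (schmidt_vec n p e) j)
    = (\<Sum>i<2. p i * (\<Prod>k<m. (cmod (e k i \<bullet>c b k (j k)))\<^sup>2))"
proof -
  \<comment> \<open>The tensor factors of the \<open>i\<close>-th Schmidt term after projection:
    unnormalized at measured sites, untouched elsewhere.\<close>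
  define y where "y i k = (if k < m then (e k i \<bullet>c b k (j k)) \<cdot>\<^sub>v b k (j k) else e k i)" for i k
  let ?P = "first_projector n m b j"
  have ec: "e k i \<in> carrier_vec 2" if "k < n" "i < 2" for k i
    using e that by (auto intro: orthonormal_basis_carrier)
  have bc: "b k (j k) \<in> carrier_vec 2" if "k < m" for k
    using b j that by (auto intro: orthonormal_basis_carrier)
  have yc: "y i k \<in> carrier_vec 2" if "k < n" "i < 2" for i k
    using ec[OF that] bc by (simp add: y_def)
  have Pt: "?P *\<^sub>v tensor_vec n (\<lambda>k. e k i) = tensor_vec n (y i)" if i: "i < 2" for i
    unfolding first_projector_def using ec[OF _ i] bc m
    by (subst tensor_mat_mult_vec)
      (auto simp: y_def outer_prod_mult_vec[of _ 2] intro!: outer_prod_carrier tensor_vec_cong)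
  have T: "branch n m b (schmidt_vec n p e) j = complex_of_real (sqrt (p 0)) \<cdot>\<^sub>v tensor_vec n (y 0)
      + complex_of_real (sqrt (p 1)) \<cdot>\<^sub>v tensor_vec n (y 1)"
    unfolding branch_def schmidt_vec_def
    by (subst mult_add_distrib_mat_vec[OF first_projector_carrier])
      (simp_all add: mult_mat_vec[OF first_projector_carrier] Pt)
  have "\<exists>k<n. y 0 k \<bullet>c y 1 k = 0"
  proof (cases "m < n")
    case True
    then show ?thesis using e orthonormal_basis_cscalar_prod[of 2 "e m" 0 1]
      by (intro exI[of _ m]) (simp add: y_def)
  next
    case False
    then obtain k where k: "k < m" "e k 0 \<bullet>c b k (j k) = 0 \<or> e k 1 \<bullet>c b k (j k) = 0" using orth by blast
    have "y 0 k \<bullet>c y 1 k = (e k 0 \<bullet>c b k (j k)) * (b k (j k) \<bullet>c ((e k 1 \<bullet>c b k (j k)) \<cdot>\<^sub>v b k (j k)))"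
      using k(1) bc[OF k(1)] by (simp add: y_def)
    also have "\<dots> = (e k 0 \<bullet>c b k (j k)) * (cnj (e k 1 \<bullet>c b k (j k)) * (b k (j k) \<bullet>c b k (j k)))"
      by (simp only: cscalar_prod_smult_right[OF bc[OF k(1)] bc[OF k(1)]])
    finally have "y 0 k \<bullet>c y 1 k = 0" using k(2) by (elim disjE) (simp_all only: mult_zero_left mult_zero_right complex_cnj_zero)
    then show ?thesis using k m by (intro exI[of _ k]) auto
  qed
  then have "tensor_vec n (y 0) \<bullet>c tensor_vec n (y 1) = 0"
    by (subst tensor_vec_cscalar_prod) (auto simp: yc)
  then have "sq_norm_cvec (branch n m b (schmidt_vec n p e) j)
      = p 0 * sq_norm_cvec (tensor_vec n (y 0)) + p 1 * sq_norm_cvec (tensor_vec n (y 1))"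
    unfolding T using p by (subst sq_norm_add_orthogonal[of _ "2 ^ n"]) auto
  moreover have "sq_norm_cvec (tensor_vec n (y i)) = (\<Prod>k<m. (cmod (e k i \<bullet>c b k (j k)))\<^sup>2)" if i: "i < 2" for i
  proof -
    have "sq_norm_cvec (tensor_vec n (y i)) = (\<Prod>k<n. sq_norm_cvec (y i k))"
      using yc i by (intro sq_norm_tensor_vec)
    also have "\<dots> = (\<Prod>k<m. sq_norm_cvec (y i k))"
      using m e i by (intro prod.mono_neutral_right) (auto simp: y_def orthonormal_basis_sq_norm)
    also have "\<dots> = (\<Prod>k<m. (cmod (e k i \<bullet>c b k (j k)))\<^sup>2)"
    proof (intro prod.cong refl)
      fix k assume "k \<in> {..<m}"
      then have k: "k < m" by simp
      have "sq_norm_cvec (b k (j k)) = 1" using b j k by (auto intro: orthonormal_basis_sq_norm)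
      then show "sq_norm_cvec (y i k) = (cmod (e k i \<bullet>c b k (j k)))\<^sup>2"
        using k by (simp add: y_def sq_norm_cvec_smult)
    qed
    finally show ?thesis .
  qed
  ultimately show ?thesis by (simp add: sum_lessThan_2)
qed

lemma branch_entropy_schmidt_zero:
  assumes n: "n > 0" and e: "\<forall>k<n. orthonormal_basis 2 (e k)"
    and p: "p 0 \<ge> 0" "p 1 \<ge> 0" "p 0 + p 1 = 1"
  shows "branch_entropy n 0 b (schmidt_vec n p e) = 0"
  using p n by (simp add: branch_entropy_def sq_norm_branch_schmidt_vec[OF _ e] sum_lessThan_2 entropy_term_def)

text \<open>The first measurement turns \<open>p\<close> into a doubly stochastic image of \<open>p\<close>, since the other
  qubits make the two Schmidt terms orthogonal.\<close>

lemma branch_entropy_schmidt_one_ge: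
  assumes n: "n \<ge> 2" and e: "\<forall>k<n. orthonormal_basis 2 (e k)" and b: "orthonormal_basis 2 (b 0)"
    and p: "p 0 \<ge> 0" "p 1 \<ge> 0"
  shows "entropy_term (p 0) + entropy_term (p 1) \<le> branch_entropy n (Suc 0) b (schmidt_vec n p e)"
proof -
  \<comment> \<open>Squared overlaps of the Schmidt basis with the measured basis of the first
    qubit.\<close>
  define w where "w i a = (cmod (e 0 i \<bullet>c b 0 a))\<^sup>2" for i a
  have e0: "orthonormal_basis 2 (e 0)" using e n by simp
  have rows: "w i 0 + w i 1 = 1" if "i < 2" for i
    using orthonormal_basis_transition_sum[OF b orthonormal_basis_carrier[OF e0 that] orthonormal_basis_sq_norm[OF e0 that]]
    by (simp add: sum_lessThan_2 w_def)
  have cols: "w 0 a + w 1 a = 1" if a: "a < 2" for a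
  proof -
    have "w i a = (cmod (b 0 a \<bullet>c e 0 i))\<^sup>2" if "i < 2" for i
      unfolding w_def
      using cmod_cscalar_prod_commute[OF orthonormal_basis_carrier[OF b a] orthonormal_basis_carrier[OF e0 that]]
      by simp
    then show ?thesis
      using orthonormal_basis_transition_sum[OF e0 orthonormal_basis_carrier[OF b a] orthonormal_basis_sq_norm[OF b a]]
      by (simp add: sum_lessThan_2)
  qed
  have nonneg: "w i a \<ge> 0" for i a by (simp add: w_def)
  have q: "sq_norm_cvec (branch n (Suc 0) b (schmidt_vec n p e) (j(0 := a))) = w 0 a * p 0 + w 1 a * p 1"
    if "a < 2" for j a
    using n b p that
    by (subst sq_norm_branch_schmidt_vec[OF _ e]) (auto simp: sum_lessThan_2 w_def mult.commute)
  \<comment> \<open>Row sums spread each term over the two outcomes; column sums make the weights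
    for each outcome convex, as concavity requires.\<close>
  have "entropy_term (p 0) + entropy_term (p 1)
      = (w 0 0 + w 0 1) * entropy_term (p 0) + (w 1 0 + w 1 1) * entropy_term (p 1)"
    using rows by simp
  also have "\<dots> = (\<Sum>a<2. w 0 a * entropy_term (p 0) + w 1 a * entropy_term (p 1))"
    by (simp add: sum_lessThan_2 algebra_simps)
  also have "\<dots> \<le> (\<Sum>a<2. entropy_term (w 0 a * p 0 + w 1 a * p 1))"
    using p nonneg cols by (intro sum_mono entropy_term_concave) auto
  also have "\<dots> = branch_entropy n (Suc 0) b (schmidt_vec n p e)"
    unfolding branch_entropy_def sum_PiE_lessThan_Suc by (simp add: q)
  finally show ?thesis .
qed

text \<open>The induction starts at one measured qubit, where the mixture formula holds for any
  basis because \<open>n >= 2\<close>. Monotonicity then reaches \<open>m = n\<close>, where that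
  formula may fail for a general basis.\<close>

lemma branch_entropy_schmidt_ge:
  assumes n: "n \<ge> 2" and e: "\<forall>k<n. orthonormal_basis 2 (e k)" and b: "\<forall>k<m. orthonormal_basis 2 (b k)"
    and p: "p 0 \<ge> 0" "p 1 \<ge> 0" and m: "0 < m" "m \<le> n"
  shows "entropy_term (p 0) + entropy_term (p 1) \<le> branch_entropy n m b (schmidt_vec n p e)"
  using m b
proof (induction m rule: nat_induct_non_zero)
  case 1
  then show ?case using branch_entropy_schmidt_one_ge[OF n e _ p] by simp
next
  case (Suc m)
  \<comment> \<open>\<open>b(m := b m)\<close> is \<open>b\<close> itself, in the shape that the
    one-step bound expects.\<close>
  then have "branch_entropy n m b (schmidt_vec n p e) \<le> branch_entropy n (Suc m) (b(m := b m)) (schmidt_vec n p e)"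
    by (intro branch_entropy_le_Suc schmidt_vec_carrier) auto
  then show ?case using Suc by simp
qed

text \<open>In the Schmidt bases the outcomes are perfectly correlated: only the two constant tuples
  have nonzero weight, \<open>p 0\<close> and \<open>p 1\<close>, for every positive number of
  measured qubits.\<close>

lemma branch_entropy_schmidt_basis:
  assumes e: "\<forall>k<n. orthonormal_basis 2 (e k)"
    and p: "p 0 \<ge> 0" "p 1 \<ge> 0" and m: "0 < m" "m \<le> n"
  shows "branch_entropy n m e (schmidt_vec n p e) = entropy_term (p 0) + entropy_term (p 1)"
proof -
  let ?J = "{..<m} \<rightarrow>\<^sub>E {..<2::nat}"
  \<comment> \<open>The constant tuple, restricted so that it belongs to the extensional function
    space \<open>?J\<close>.\<close>
  define c where "c i = (\<lambda>k\<in>{..<m}. i)" for i :: nat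
  have cJ: "c i \<in> ?J" if "i < 2" for i using that by (auto simp: c_def)
  have c0: "c i 0 = i" for i using m by (simp add: c_def)
  have q: "sq_norm_cvec (branch n m e (schmidt_vec n p e) j) = (\<Sum>i<2. p i * (if j = c i then 1 else 0))"
    if j: "j \<in> ?J" for j
  proof -
    have dig: "j k < 2" if "k < m" for k using j that by auto
    have ej: "e k i \<bullet>c e k (j k) = (if i = j k then 1 else 0)" if "k < m" "i < 2" for i k
      using e that m dig by (intro orthonormal_basis_cscalar_prod) auto
    \<comment> \<open>Whichever Schmidt vector is the outcome, it is orthogonal to the other one;
      this excludes interference even if all qubits are measured.\<close>
    have orth: "e 0 0 \<bullet>c e 0 (j 0) = 0 \<or> e 0 1 \<bullet>c e 0 (j 0) = 0"
      using ej[of 0 0] ej[of 0 1] m by (cases "j 0 = 0") auto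
    have "sq_norm_cvec (branch n m e (schmidt_vec n p e) j)
        = (\<Sum>i<2. p i * (\<Prod>k<m. (cmod (e k i \<bullet>c e k (j k)))\<^sup>2))"
      using e m dig p orth by (intro sq_norm_branch_schmidt_vec) auto
    also have "\<dots> = (\<Sum>i<2. p i * (if j = c i then 1 else 0))"
    proof (intro sum.cong refl arg_cong2[of _ _ _ _ "(*)"])
      fix i :: nat assume "i \<in> {..<2}"
      then have i: "i < 2" by simp
      show "(\<Prod>k<m. (cmod (e k i \<bullet>c e k (j k)))\<^sup>2) = (if j = c i then 1 else 0)"
      proof (cases "j = c i")
        case True
        then show ?thesis using ej i by (auto intro!: prod.neutral simp: c_def)
      next
        case False
        then obtain k where "k < m" "j k \<noteq> i"
          using PiE_ext[OF j cJ[OF i]] by (auto simp: c_def)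
        then show ?thesis using False ej i by (auto intro!: prod_zero bexI[of _ k])
      qed
    qed
    finally show ?thesis .
  qed
  have c01: "c 0 \<noteq> c 1" using c0 by (metis zero_neq_one)
  have "branch_entropy n m e (schmidt_vec n p e)
      = (\<Sum>j\<in>?J. entropy_term (\<Sum>i<2. p i * (if j = c i then 1 else 0)))"
    unfolding branch_entropy_def by (intro sum.cong refl) (simp add: q)
  also have "\<dots> = (\<Sum>j\<in>{c 0, c 1}. entropy_term (\<Sum>i<2. p i * (if j = c i then 1 else 0)))"
    using cJ by (intro sum.mono_neutral_right) (auto simp: finite_PiE sum_lessThan_2 entropy_term_def)
  also have "\<dots> = entropy_term (p 0) + entropy_term (p 1)"
    using c01 by (simp add: sum_lessThan_2)
  finally show ?thesis .
qed

theorem mainTheorem2: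
  fixes n :: nat and kB T S :: real and p :: "nat \<Rightarrow> real"
    and e :: "nat \<Rightarrow> nat \<Rightarrow> complex vec" and \<psi> :: "complex vec" and \<rho> :: "complex mat"
  assumes "n \<ge> 2" and "kB > 0" and "T > 0"
    and "\<forall>k<n. orthonormal_basis 2 (e k)"
    and "p 0 \<ge> 0" and "p 1 \<ge> 0" and "p 0 + p 1 = 1"
    and "\<psi> = complex_of_real (sqrt (p 0)) \<cdot>\<^sub>v tensor_vec n (\<lambda>k. e k 0)
           + complex_of_real (sqrt (p 1)) \<cdot>\<^sub>v tensor_vec n (\<lambda>k. e k 1)"
    and "\<rho> = outer_prod \<psi> \<psi>"
    and "S = - (\<Sum>i<2. p i * log 2 (p i))"
  shows "thermal_gqd n \<rho> = S \<and>
         total_work_difference kB T n \<rho> = kB * T * thermal_gqd n \<rho> \<and>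
         kB * T * thermal_gqd n \<rho> = kB * T * S"
proof -
  note n = assms(1) and e = assms(4) and p = assms(5,6)
  have \<psi>: "\<psi> = schmidt_vec n p e" using assms(8) by (simp add: schmidt_vec_def)
  have psi: "\<psi> \<in> carrier_vec (2 ^ n)" unfolding \<psi> by (rule schmidt_vec_carrier)
  have S: "S = entropy_term (p 0) + entropy_term (p 1)"
    using assms(10) by (simp add: sum_lessThan_2 entropy_term_def)
  have ge: "S \<le> branch_entropy n m b \<psi>" if "0 < m" "m \<le> n" "\<forall>k<m. orthonormal_basis 2 (b k)" for m b
    unfolding S \<psi> using branch_entropy_schmidt_ge[OF n e that(3) p that(1,2)] .
  have eq: "branch_entropy n m e \<psi> = S" if "0 < m" "m \<le> n" for m
    unfolding S \<psi> using branch_entropy_schmidt_basis[OF e p that] .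
  have zero: "branch_entropy n 0 b \<psi> = 0" for b
    unfolding \<psi> using n by (intro branch_entropy_schmidt_zero e p assms(7)) auto
  \<comment> \<open>Normalization enters here: the only branch before any measurement is
    \<open>\<psi>\<close>, of squared norm \<open>p 0 + p 1 = 1\<close>.\<close>
  have ent: "von_neumann_entropy \<rho> = 0"
    using von_neumann_entropy_measure_first[of 0 n e \<psi>] psi
    by (simp add: measure_first_zero assms(9) zero)
  have full: "von_neumann_entropy (measure_first n n b \<rho>) = branch_entropy n n b \<psi>"
    if "\<forall>k<n. orthonormal_basis 2 (b k)" for b
    unfolding assms(9) by (rule von_neumann_entropy_measure_first[OF order_refl that psi])
  have gqd: "thermal_gqd n \<rho> = S"
    unfolding thermal_gqd_def ent
  proof (rule Least_equality)
    show "\<exists>b. (\<forall>k<n. orthonormal_basis 2 (b k)) \<and> S = von_neumann_entropy (measure_first n n b \<rho>) - 0"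
      using e full[OF e] eq[of n] n by (intro exI[of _ e]) simp
  next
    fix x assume "\<exists>b. (\<forall>k<n. orthonormal_basis 2 (b k)) \<and> x = von_neumann_entropy (measure_first n n b \<rho>) - 0"
    then show "S \<le> x" using full ge[of n] n by auto
  qed
  have first: "thermal_discord n \<rho> 0 = S"
  proof -
    have "thermal_discord n \<rho> 0 = (LEAST x. \<exists>u. orthonormal_basis 2 u \<and>
        x = branch_entropy n (Suc 0) (e(0 := u)) \<psi> - branch_entropy n 0 e \<psi>)"
      using thermal_discord_measure_first[of 0 n e \<psi>] n psi by (simp add: measure_first_zero assms(9))
    also have "\<dots> = S"
    proof (rule Least_equality)
      show "\<exists>u. orthonormal_basis 2 u \<and> S = branch_entropy n (Suc 0) (e(0 := u)) \<psi> - branch_entropy n 0 e \<psi>"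
        using e n eq[of 1] by (intro exI[of _ "e 0"]) (simp add: zero)
    next
      fix x assume "\<exists>u. orthonormal_basis 2 u \<and> x = branch_entropy n (Suc 0) (e(0 := u)) \<psi> - branch_entropy n 0 e \<psi>"
      then show "S \<le> x" using ge[of "Suc 0"] n by (auto simp: zero)
    qed
    finally show ?thesis .
  qed
  have rest: "(LEAST x. \<exists>b. (\<forall>k<i. orthonormal_basis 2 (b k)) \<and>
         x = thermal_discord n (measure_first n i b \<rho>) i) = 0" if i: "1 \<le> i" "i < n" for i
  proof (rule Least_equality)
    have ei: "\<forall>k<i. orthonormal_basis 2 (e k)" using e i by simp
    \<comment> \<open>Once a qubit has been measured in its Schmidt basis, the entropy is already
      \<open>S\<close>, and continuing with \<open>e i\<close> adds nothing; zero is the least gain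
      by monotonicity.\<close>
    have "thermal_discord n (measure_first n i e \<rho>) i = 0"
      unfolding assms(9) thermal_discord_measure_first[OF i(2) ei psi]
    proof (rule Least_equality)
      show "\<exists>u. orthonormal_basis 2 u \<and> 0 = branch_entropy n (Suc i) (e(i := u)) \<psi> - branch_entropy n i e \<psi>"
        using e i eq[of i] eq[of "Suc i"] by (intro exI[of _ "e i"]) simp
    next
      fix x assume "\<exists>u. orthonormal_basis 2 u \<and> x = branch_entropy n (Suc i) (e(i := u)) \<psi> - branch_entropy n i e \<psi>"
      then show "0 \<le> x" using branch_entropy_le_Suc[OF i(2) ei _ psi] by auto
    qed
    then show "\<exists>b. (\<forall>k<i. orthonormal_basis 2 (b k)) \<and> 0 = thermal_discord n (measure_first n i b \<rho>) i"
      using ei by (intro exI[of _ e]) simp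
  next
    \<comment> \<open>Here the earlier measurements are arbitrary, so the inner minimum has no
      explicit witness; nonnegativity rests on the compactness argument.\<close>
    fix x assume "\<exists>b. (\<forall>k<i. orthonormal_basis 2 (b k)) \<and> x = thermal_discord n (measure_first n i b \<rho>) i"
    then show "0 \<le> x" using thermal_discord_measure_first_nonneg[OF i(2) _ psi] by (auto simp: assms(9))
  qed
  have "total_work_difference kB T n \<rho> = kB * T * S"
    unfolding total_work_difference_def first using rest by simp
  then show ?thesis using gqd by simp
qed

end
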